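(* Let $H$ be a non-critical, prime, 3-uniform hypergraph. Consider a vertex $x$ of $H$ such that $H-x$ is prime, and suppose that $H-x$ admits a realization $T_x$. Then $H$ is realizable if and only if the following two assertions hold. (M1) There exists a bipartition $\{X^-,X^+\}$ of $V_x\setminus I_x$ satisfying: - for each component $C$ of the graph $G_x$ with $v(C)\geq 2$, $C$ is bipartite with bipartition $\{X^-\cap V(C),X^+\cap V(C)\}$; - for all $v^-\in X^-$ and $v^+\in X^+$, $v^-v^+\in E(G_x)$ if and only if $v^-v^+\in A(T_x)$. (M2) For this bipartition $\{X^-,X^+\}$ and the associated sets $Y^-,Y^+$ (defined in the context), we have $Y^-\cap Y^+=\emptyset$ and $Y^-\cup Y^+=I_x$. Furthermore, for all $x^-\in X^-$, $x^+\in X^+$, $y^-\in Y^-$ and $y^+\in Y^+$, we have $y^+x^-,\,x^+y^-,\,y^+y^-\in A(T_x)$. Moreover, if $H$ is realizable, then there exists a unique realization $T$ of $H$ such that $T-x=T_x$. Precisely, if $T$ is a realization of $H$ such that $T-x=T_x$, then for all $x^-\in X^-$, $x^+\in X^+$, $y^-\in Y^-$ and $y^+\in Y^+$, we have $xx^-,\,x^+x,\,xy^-,\,y^+x\in A(T)$.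
   Context: All structures are finite. A 3-uniform hypergraph $H$ consists of a vertex set $V(H)$ and an edge set $E(H)\subseteq\binom{V(H)}{3}$. For $v\in V(H)$, $H-v$ is the subhypergraph of $H$ induced by $V(H)\setminus\{v\}$; similarly $T-v$ for a tournament $T$. In a tournament $T$ with arc set $A(T)$, for distinct vertices $v,w$ exactly one of $vw$ (arc from $v$ to $w$), $wv$ belongs to $A(T)$. A subset $M$ of $V(H)$ is a module of $H$ if for each $e\in E(H)$ such that $e\cap M\neq\emptyset$ and $e\setminus M\neq\emptyset$, there exists $m\in M$ such that $e\cap M=\{m\}$ and for every $n\in M$, $(e\setminus\{m\})\cup\{n\}\in E(H)$. The sets $\emptyset$, $V(H)$ and $\{v\}$ ($v\in V(H)$) are modules, called trivial. $H$ is decomposable if it has a nontrivial module; $H$ is prime if $|V(H)|\geq 3$ and all its modules are trivial. A prime $H$ is critical if $H-v$ is decomposable for every $v\in V(H)$. A 3-cycle is a tournament on three vertices isomorphic to $(\{0,1,2\},\{01,12,20\})$. The $C_3$-structure $C_3(T)$ of a tournament $T$ is the 3-uniform hypergraph on $V(T)$ whose edges are the 3-element subsets $X$ of $V(T)$ such that $T[X]$ is a 3-cycle. A tournament $T$ with $V(T)=V(H)$ is a realization of $H$ if $H=C_3(T)$; $H$ is realizable if it admits a realization. For a vertex $x$ of $H$: $V_x=V(H)\setminus\{x\}$; $G_x$ is the graph on $V_x$ in which distinct $v,w$ are adjacent iff $\{x,v,w\}\in E(H)$; $I_x$ is the set of isolated vertices of $G_x$. A component of $G_x$ is a maximal connected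 (induced) subgraph $C$, and $v(C)=|V(C)|$. Given a realization $T_x$ of $H-x$ and a bipartition of $V_x\setminus I_x$ whose two blocks are denoted $X^-$ and $X^+$: $Y^-$ is the set of $v\in I_x$ for which there exists a sequence $v_0,\ldots,v_n$ with $v_0\in X^-$, $v_n=v$, $v_1,\ldots,v_n\in I_x$, and $v_iv_{i+1}\in A(T_x)$ for $i=0,\ldots,n-1$. Dually, $Y^+$ is the set of $v\in I_x$ for which there exists a sequence $v_0,\ldots,v_n$ with $v_0\in X^+$, $v_n=v$, $v_1,\ldots,v_n\in I_x$, and $v_{i+1}v_i\in A(T_x)$ for $i=0,\ldots,n-1$. In the "Moreover" part, $X^-,X^+,Y^-,Y^+$ are the sets provided by (M1) and (M2). *)

theory Defs
  imports "Graph_Theory.Graph_Theory" "HOL-Library.Disjoint_Sets"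
begin

record 'a hypergraph =
  hverts :: "'a set"
  hedges :: "'a set set"

definition three_uniform :: "'a hypergraph \<Rightarrow> bool" where
  "three_uniform H \<longleftrightarrow> finite (hverts H) \<and> (\<forall>e \<in> hedges H. e \<subseteq> hverts H \<and> card e = 3)"

definition hdel :: "'a hypergraph \<Rightarrow> 'a \<Rightarrow> 'a hypergraph" where
  "hdel H v = \<lparr>hverts = hverts H - {v}, hedges = {e \<in> hedges H. e \<subseteq> hverts H - {v}}\<rparr>"

definition is_module :: "'a hypergraph \<Rightarrow> 'a set \<Rightarrow> bool" where
  "is_module H M \<longleftrightarrow> M \<subseteq> hverts H \<and>
    (\<forall>e \<in> hedges H. e \<inter> M \<noteq> {} \<and> e - M \<noteq> {} \<longrightarrow>
      (\<exists>m \<in> M. e \<inter> M = {m} \<and> (\<forall>n \<in> M. (e - {m}) \<union> {n} \<in> hedges H)))"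

definition trivial_module :: "'a hypergraph \<Rightarrow> 'a set \<Rightarrow> bool" where
  "trivial_module H M \<longleftrightarrow> M = {} \<or> M = hverts H \<or> (\<exists>v \<in> hverts H. M = {v})"

definition decomposable :: "'a hypergraph \<Rightarrow> bool" where
  "decomposable H \<longleftrightarrow> (\<exists>M. is_module H M \<and> \<not> trivial_module H M)"

definition prime_hypergraph :: "'a hypergraph \<Rightarrow> bool" where
  "prime_hypergraph H \<longleftrightarrow>
    card (hverts H) \<ge> 3 \<and> (\<forall>M. is_module H M \<longrightarrow> trivial_module H M)"

definition critical :: "'a hypergraph \<Rightarrow> bool" where
  "critical H \<longleftrightarrow> prime_hypergraph H \<and> (\<forall>v \<in> hverts H. decomposable (hdel H v))"

definition tournament :: "'a pair_pre_digraph \<Rightarrow> bool" where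
  "tournament T \<longleftrightarrow> pair_digraph T \<and>
    (\<forall>v \<in> pverts T. \<forall>w \<in> pverts T. v \<noteq> w \<longrightarrow> ((v, w) \<in> parcs T \<longleftrightarrow> (w, v) \<notin> parcs T))"

definition three_cycle :: "nat pair_pre_digraph" where
  "three_cycle = \<lparr>pverts = {0, 1, 2}, parcs = {(0, 1), (1, 2), (2, 0)}\<rparr>"

definition C3 :: "'a pair_pre_digraph \<Rightarrow> 'a hypergraph" where
  "C3 T = \<lparr>hverts = pverts T,
    hedges = {X. X \<subseteq> pverts T \<and> card X = 3 \<and>
      digraph_iso (with_proj T \<restriction> X) (with_proj three_cycle)}\<rparr>"

definition realization :: "'a pair_pre_digraph \<Rightarrow> 'a hypergraph \<Rightarrow> bool" where
  "realization T H \<longleftrightarrow> tournament T \<and> pverts T = hverts H \<and> H = C3 T"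

definition realizable :: "'a hypergraph \<Rightarrow> bool" where
  "realizable H \<longleftrightarrow> (\<exists>T. realization T H)"

text \<open>An undirected graph is a symmetric loop-free digraph, as in \<^locale>\<open>pair_graph\<close>.\<close>

definition link_graph :: "'a hypergraph \<Rightarrow> 'a \<Rightarrow> 'a pair_pre_digraph" where
  "link_graph H x = \<lparr>pverts = hverts H - {x},
    parcs = {(v, w). v \<in> hverts H - {x} \<and> w \<in> hverts H - {x} \<and> v \<noteq> w \<and>
      {x, v, w} \<in> hedges H}\<rparr>"

definition isolated_verts :: "'a pair_pre_digraph \<Rightarrow> 'a set" where
  "isolated_verts G = {v \<in> pverts G. \<forall>w \<in> pverts G. (v, w) \<notin> parcs G}"

definition is_component :: "('a, 'b) pre_digraph \<Rightarrow> ('a, 'b) pre_digraph \<Rightarrow> bool" where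
  "is_component G C \<longleftrightarrow> pre_digraph.max_subgraph G connected C"

text \<open>Both blocks are nonempty, since \<^const>\<open>partition_on\<close> excludes empty blocks.\<close>

definition bipartition :: "'a set \<Rightarrow> 'a set \<Rightarrow> 'a set \<Rightarrow> bool" where
  "bipartition S A B \<longleftrightarrow> A \<noteq> B \<and> partition_on S {A, B}"

definition bipartite_with :: "('a, 'b) pre_digraph \<Rightarrow> 'a set \<Rightarrow> 'a set \<Rightarrow> bool" where
  "bipartite_with G A B \<longleftrightarrow> bipartition (verts G) A B \<and>
    (\<forall>e \<in> arcs G. (tail G e \<in> A \<and> head G e \<in> B) \<or> (tail G e \<in> B \<and> head G e \<in> A))"

definition Y_minus :: "'a pair_pre_digraph \<Rightarrow> 'a set \<Rightarrow> 'a set \<Rightarrow> 'a set" where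
  "Y_minus T I Xm = {v \<in> I. \<exists>(n::nat) s. s 0 \<in> Xm \<and> s n = v \<and> (\<forall>i \<in> {1..n}. s i \<in> I) \<and>
    (\<forall>i < n. (s i, s (Suc i)) \<in> parcs T)}"

definition Y_plus :: "'a pair_pre_digraph \<Rightarrow> 'a set \<Rightarrow> 'a set \<Rightarrow> 'a set" where
  "Y_plus T I Xp = {v \<in> I. \<exists>(n::nat) s. s 0 \<in> Xp \<and> s n = v \<and> (\<forall>i \<in> {1..n}. s i \<in> I) \<and>
    (\<forall>i < n. (s (Suc i), s i) \<in> parcs T)}"

definition cond_M1 ::
  "'a hypergraph \<Rightarrow> 'a \<Rightarrow> 'a pair_pre_digraph \<Rightarrow> 'a set \<Rightarrow> 'a set \<Rightarrow> bool" where
  "cond_M1 H x Tx Xm Xp \<longleftrightarrow>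
    (let G = link_graph H x in
      bipartition ((hverts H - {x}) - isolated_verts G) Xm Xp \<and>
      (\<forall>C. is_component (with_proj G) C \<and> card (verts C) \<ge> 2 \<longrightarrow>
        bipartite_with C (Xm \<inter> verts C) (Xp \<inter> verts C)) \<and>
      (\<forall>vm \<in> Xm. \<forall>vp \<in> Xp. (vm, vp) \<in> parcs G \<longleftrightarrow> (vm, vp) \<in> parcs Tx))"

text \<open>The three arc conditions are quantified separately, so that one of \<open>Y\<^sup>-\<close>, \<open>Y\<^sup>+\<close> being
  empty does not make the remaining condition vacuous.\<close>

definition cond_M2 ::
  "'a hypergraph \<Rightarrow> 'a \<Rightarrow> 'a pair_pre_digraph \<Rightarrow> 'a set \<Rightarrow> 'a set \<Rightarrow> bool" where
  "cond_M2 H x Tx Xm Xp \<longleftrightarrow>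
    (let I = isolated_verts (link_graph H x); Ym = Y_minus Tx I Xm; Yp = Y_plus Tx I Xp in
      Ym \<inter> Yp = {} \<and> Ym \<union> Yp = I \<and>
      (\<forall>yp \<in> Yp. \<forall>xm \<in> Xm. (yp, xm) \<in> parcs Tx) \<and>
      (\<forall>xp \<in> Xp. \<forall>ym \<in> Ym. (xp, ym) \<in> parcs Tx) \<and>
      (\<forall>yp \<in> Yp. \<forall>ym \<in> Ym. (yp, ym) \<in> parcs Tx))"

end

theory Submission
  imports Defs
begin

text \<open>
  A realization of \<open>H\<close> extending \<open>T\<^sub>x\<close> amounts to a set \<open>N\<close> (the vertices dominated by \<open>x\<close>)
  such that the arcs of \<open>T\<^sub>x\<close> from \<open>N\<close> to its complement are exactly the edges of the link graph
  \<open>G\<^sub>x\<close>. Given \<open>N\<close>, put \<open>X\<^sup>- = N - I\<^sub>x\<close>: walks in \<open>I\<^sub>x\<close> starting in \<open>X\<^sup>-\<close> cannot leave \<open>N\<close>, and the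
  vertices of \<open>N \<inter> I\<^sub>x\<close> that no such walk reaches would form a module of \<open>H\<close> together with \<open>x\<close>.
  Conversely \<open>X\<^sup>- \<union> Y\<^sup>-\<close> is such a set \<open>N\<close>.

  Uniqueness, and the reduction to realizations that extend \<open>T\<^sub>x\<close> itself, rest on the theorem of
  Boussairi, Ille, Lopez and Thomasse that a prime \<open>C\<^sub>3\<close>-structure has only two realizations, dual to
  each other. Colour a pair of vertices by whether two given realizations agree on it.
  Three-cycles are monochromatic. If both colours occur, then a maximal proper module of the
  colouring is a module of the tournament, so the colouring is prime; but for a three-cycle
  \<open>a b c\<close> of colour \<open>k\<close>, the arcs forming a three-cycle of colour \<open>k\<close> with \<open>a\<close> have a connected
  component through \<open>b c\<close>, and its vertex set is a module of the colouring that avoids \<open>a\<close>.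
\<close>

section \<open>Tournaments with the same three-cycles\<close>

text \<open>
  \<open>R\<close> is the arc relation and \<open>col u v\<close> says that the other tournament agrees on \<open>u, v\<close>. The
  assumption \<open>minority\<close> expresses that reversing the arcs of one colour turns no transitive triple
  into a three-cycle.
\<close>

locale coloured_tournament =
  fixes V :: "'a set" and R :: "'a \<Rightarrow> 'a \<Rightarrow> bool" and col :: "'a \<Rightarrow> 'a \<Rightarrow> bool"
  assumes finite_V: "finite V"
    and irrefl: "\<not> R u u"
    and total: "\<lbrakk>u \<in> V; v \<in> V; u \<noteq> v\<rbrakk> \<Longrightarrow> R u v \<longleftrightarrow> \<not> R v u"
    and col_sym: "\<lbrakk>u \<in> V; v \<in> V; u \<noteq> v\<rbrakk> \<Longrightarrow> col u v = col v u"
    and cycle_mono: "\<lbrakk>u \<in> V; v \<in> V; w \<in> V; R u v; R v w; R w u\<rbrakk> \<Longrightarrow> col u v = col v w"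
    and minority: "\<lbrakk>u \<in> V; v \<in> V; w \<in> V; u \<noteq> v; u \<noteq> w; v \<noteq> w; col u v = col u w; col u v \<noteq> col v w\<rbrakk>
      \<Longrightarrow> R u v \<longleftrightarrow> R u w"
    and prime: "\<lbrakk>M \<subseteq> V; \<And>u m n. \<lbrakk>u \<in> V - M; m \<in> M; n \<in> M\<rbrakk> \<Longrightarrow> R u m \<longleftrightarrow> R u n\<rbrakk>
      \<Longrightarrow> card M \<le> 1 \<or> M = V"
begin

text \<open>The component of \<open>a\<close> in the graph of colour \<open>k\<close> is a module of
  the tournament: a vertex \<open>u\<close> outside it sees the ends of a \<open>k\<close>-edge in
  the other colour, so \<open>minority\<close> makes \<open>u\<close> treat both alike. As the
  component contains \<open>a\<close> and \<open>b\<close>, \<open>prime\<close> forces it to be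
  \<open>V\<close>.\<close>

lemma colour_class_connected:
  assumes ab: "a \<in> V" "b \<in> V" "a \<noteq> b" "col a b = k"
    and M: "M \<subseteq> V" "M \<noteq> {}" "M \<noteq> V"
  obtains m u where "m \<in> M" "u \<in> V - M" "col m u = k"
proof -
  define E where "E = {(p, q). p \<in> V \<and> q \<in> V \<and> p \<noteq> q \<and> col p q = k}"
  define K where "K = {v. (a, v) \<in> E\<^sup>*}"
  have KV: "K \<subseteq> V"
  proof
    fix v assume "v \<in> K"
    hence "(a, v) \<in> E\<^sup>*" by (simp add: K_def)
    thus "v \<in> V" by (induction) (use ab in \<open>auto simp: E_def\<close>)
  qed
  have unif: "R u a \<longleftrightarrow> R u v" if u: "u \<in> V - K" and v: "v \<in> K" for u v
  proof -
    have "(a, v) \<in> E\<^sup>*" using v by (simp add: K_def)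
    thus ?thesis
    proof (induction)
      case (step y z)
      have yK: "y \<in> K" and zK: "z \<in> K" using step by (auto simp: K_def)
      have yz: "y \<in> V" "z \<in> V" "y \<noteq> z" "col y z = k" using step by (auto simp: E_def)
      have "col u y \<noteq> k" "col u z \<noteq> k"
        using u yK zK yz col_sym[of u y] col_sym[of u z] unfolding K_def E_def
        by (auto dest: rtrancl_into_rtrancl)
      hence "R u y \<longleftrightarrow> R u z" using minority[of u y z] u yK zK yz by auto
      thus ?case using step.IH by simp
    qed simp
  qed
  have "a \<in> K" "b \<in> K" using ab by (auto simp: K_def E_def)
  hence "\<not> card K \<le> 1"
    using ab(3) finite_subset[OF KV finite_V] by (metis One_nat_def card_le_Suc0_iff_eq)
  moreover have "card K \<le> 1 \<or> K = V" by (rule prime[OF KV]) (use unif in blast)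
  ultimately have K: "K = V" by simp
  have *: "\<exists>p\<in>L. \<exists>q\<in>V - L. col p q = k" if L: "a \<in> L" "L \<noteq> V" "L \<subseteq> V" for L
  proof (rule ccontr)
    assume neg: "\<not> ?thesis"
    have "v \<in> L" if "(a, v) \<in> E\<^sup>*" for v
      using that by (induction) (use L neg in \<open>auto simp: E_def\<close>)
    hence "V \<subseteq> L" using K by (auto simp: K_def)
    thus False using L by blast
  qed
  show ?thesis
  proof (cases "a \<in> M")
    case True
    thus ?thesis using *[of M] M that by blast
  next
    case False
    obtain p q where "p \<in> V - M" "q \<in> V - (V - M)" "col p q = k"
      using *[of "V - M"] False ab(1) M by blast
    thus ?thesis using that[of q p] col_sym[of p q] M by auto
  qed
qed

definition colour_module :: "'a set \<Rightarrow> bool" where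
  "colour_module M \<longleftrightarrow> M \<subseteq> V \<and> (\<forall>u\<in>V - M. \<forall>m\<in>M. \<forall>n\<in>M. col u m = col u n)"

lemma colour_module_trivial:
  assumes both: "\<And>k. \<exists>a\<in>V. \<exists>b\<in>V. a \<noteq> b \<and> col a b = k"
    and M0: "colour_module M0" "M0 \<noteq> V"
  shows "card M0 \<le> 1"
proof (rule ccontr)
  assume "\<not> card M0 \<le> 1"
  define F where "F = {M. colour_module M \<and> M \<noteq> V \<and> \<not> card M \<le> 1}"
  have "finite F" using finite_V by (rule_tac finite_subset[of _ "Pow V"]) (auto simp: F_def colour_module_def)
  moreover have "M0 \<in> F" using M0 \<open>\<not> card M0 \<le> 1\<close> by (simp add: F_def)
  ultimately obtain M where M: "M \<in> F" and mx: "\<And>N. N \<in> F \<Longrightarrow> M \<subseteq> N \<Longrightarrow> M = N"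
    using finite_has_maximal2[of F M0] by (metis (no_types, lifting))
  have Mm: "colour_module M" and MnV: "M \<noteq> V" and cM: "\<not> card M \<le> 1"
    using M unfolding F_def by blast+
  have MV: "M \<subseteq> V" using Mm unfolding colour_module_def by blast
  have "R u m \<longleftrightarrow> R u n" if u: "u \<in> V - M" and mn: "m \<in> M" "n \<in> M" for u m n
  proof (rule ccontr)
    assume bad: "\<not> ?thesis"
    define k where "k = col u m"
    txt \<open>By \<open>minority\<close>, adding to \<open>M\<close> the vertices \<open>B\<close> that distinguish elements of \<open>M\<close> and have
      colour \<open>k\<close> to \<open>M\<close> yields a colour module again, so \<open>M \<union> B = V\<close>; but then no arc of the
      other colour leaves \<open>M\<close>.\<close>
    define P where "P = {w \<in> V - M. col w m = k}"
    define B where "B = {w \<in> P. \<exists>p\<in>M. \<exists>q\<in>M. R w p \<noteq> R w q}"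
    have colm: "col w p = col w q" if "w \<in> V - M" "p \<in> M" "q \<in> M" for w p q
      using Mm that unfolding colour_module_def by blast
    have uB: "u \<in> B" using bad u mn by (auto simp: B_def P_def k_def)
    have BV: "B \<subseteq> V - M" by (auto simp: B_def P_def)
    have out: "col w b = col w m" if w: "w \<in> V - (M \<union> B)" and b: "b \<in> B" for w b
    proof (rule ccontr)
      assume ne: "col w b \<noteq> col w m"
      have bV: "b \<in> V - M" "col b m = k" using b by (auto simp: B_def P_def)
      show False
      proof (cases "col w m = k")
        case True
        have wP: "w \<in> P" using w True by (auto simp: P_def)
        have tr: "R p w \<longleftrightarrow> R p b" if p: "p \<in> M" for p
        proof (rule minority)
          show "col p w = col p b"
            using colm[of w p m] colm[of b p m] p mn w bV True MV col_sym[of p w] col_sym[of p b]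
            by auto
          show "col p w \<noteq> col w b"
            using colm[of w p m] p mn w True MV col_sym[of p w] ne by auto
        qed (use p w b bV MV in auto)
        have "R w p \<longleftrightarrow> R b p" if p: "p \<in> M" for p
          using tr[OF p] total[of p w] total[of p b] p w bV MV by auto
        moreover have "R w p \<longleftrightarrow> R w q" if "p \<in> M" "q \<in> M" for p q
          using w wP that unfolding B_def by blast
        ultimately show False using b unfolding B_def by blast
      next
        case False
        have "R b p \<longleftrightarrow> R b w" if p: "p \<in> M" for p
        proof (rule minority)
          show "col b p = col b w"
            using colm[of b p m] p mn bV w ne False col_sym[of w b] b by auto
          show "col b p \<noteq> col p w"
            using colm[of b p m] colm[of w p m] p mn bV w False col_sym[of p w] MV by auto
        qed (use p w b bV MV in auto)
        thus False using b unfolding B_def by blast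
      qed
    qed
    have cMB: "colour_module (M \<union> B)"
      unfolding colour_module_def
    proof (intro conjI ballI)
      fix w p q assume w: "w \<in> V - (M \<union> B)" and pq: "p \<in> M \<union> B" "q \<in> M \<union> B"
      have "col w p = col w m" if "p \<in> M \<union> B" for p
        using that out[OF w, of p] colm[of w p m] w mn by auto
      thus "col w p = col w q" using pq by metis
    qed (use MV BV in auto)
    have "M \<union> B = V"
    proof (rule ccontr)
      assume "M \<union> B \<noteq> V"
      moreover have "card M \<le> card (M \<union> B)"
        using MV BV finite_V by (intro card_mono) (auto intro: finite_subset)
      ultimately have "M \<union> B \<in> F" using cMB cM by (simp add: F_def)
      hence "M = M \<union> B" by (rule mx) simp
      thus False using uB BV by blast
    qed
    obtain a b where "a \<in> V" "b \<in> V" "a \<noteq> b" "col a b = (\<not> k)" using both by blast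
    then obtain p w where pw: "p \<in> M" "w \<in> V - M" "col p w = (\<not> k)"
      by (rule colour_class_connected) (use MV MnV mn in auto)
    hence "w \<in> B" using \<open>M \<union> B = V\<close> by blast
    hence "col w m = k" by (simp add: B_def P_def)
    thus False using pw colm[of w p m] mn col_sym[of w p] MV by auto
  qed
  hence "card M \<le> 1 \<or> M = V" using prime[OF MV] by blast
  thus False using MnV cM by simp
qed

lemma monochromatic:
  assumes abc: "a \<in> V" "b \<in> V" "c \<in> V" "R a b" "R b c" "R c a"
  obtains k where "\<And>u v. \<lbrakk>u \<in> V; v \<in> V; u \<noteq> v\<rbrakk> \<Longrightarrow> col u v = k"
proof (rule ccontr)
  assume neg: "\<not> thesis"
  have both: "\<exists>a\<in>V. \<exists>b\<in>V. a \<noteq> b \<and> col a b = k" for k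
  proof (rule ccontr)
    assume "\<not> ?thesis"
    hence "\<And>u v. \<lbrakk>u \<in> V; v \<in> V; u \<noteq> v\<rbrakk> \<Longrightarrow> col u v = (\<not> k)" by blast
    thus False using neg that by blast
  qed
  define k where "k = col a b"
  define S where "S = {(p, q). p \<in> V \<and> q \<in> V \<and> R p q \<and> col p q = k \<and>
    R a p \<and> col a p = k \<and> R q a \<and> col a q = k}"
  \<comment> \<open>Exchanges one end of an arc of \<open>S\<close>: \<open>minority\<close> at
    \<open>p\<close> gives \<open>q'\<close> the direction of \<open>q\<close>; at \<open>p\<close>
    again, together with \<open>a\<close>, it rules out the other colour for \<open>a q'\<close>; at
    \<open>a\<close> it closes the three-cycle. \<open>hd\<close> treats the other end in the same
    way.\<close>
  have tl: "(p, q') \<in> S" if S: "(p, q) \<in> S" and q': "q' \<in> V" "q' \<noteq> p" "q' \<noteq> q"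
      "col p q' = k" "col q q' \<noteq> k" for p q q'
  proof -
    have S': "p \<in> V" "q \<in> V" "R p q" "col p q = k" "R a p" "col a p = k" "R q a" "col a q = k"
      using S by (auto simp: S_def)
    have ne: "p \<noteq> q" "a \<noteq> p" "a \<noteq> q" using S' irrefl by auto
    have "q' \<noteq> a" using q' S' col_sym[of q a] ne abc by auto
    have 1: "R p q'" using minority[of p q q'] S' ne q' by auto
    have 2: "col a q' = k"
    proof (rule ccontr)
      assume "col a q' \<noteq> k"
      hence "R p a \<longleftrightarrow> R p q'"
        using minority[of p a q'] S' ne q' \<open>q' \<noteq> a\<close> abc col_sym[of p a] by auto
      thus False using 1 S' total[of a p] abc ne by auto
    qed
    have "R a q \<longleftrightarrow> R a q'" using minority[of a q q'] 2 S' ne q' \<open>q' \<noteq> a\<close> abc by auto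
    hence "R q' a" using S' total[of a q] total[of a q'] abc ne q' \<open>q' \<noteq> a\<close> by auto
    thus ?thesis using 1 2 S' q' by (auto simp: S_def)
  qed
  have hd: "(p', q) \<in> S" if S: "(p, q) \<in> S" and p': "p' \<in> V" "p' \<noteq> p" "p' \<noteq> q"
      "col q p' = k" "col p p' \<noteq> k" for p q p'
  proof -
    have S': "p \<in> V" "q \<in> V" "R p q" "col p q = k" "R a p" "col a p = k" "R q a" "col a q = k"
      using S by (auto simp: S_def)
    have ne: "p \<noteq> q" "a \<noteq> p" "a \<noteq> q" using S' irrefl by auto
    have "p' \<noteq> a" using p' S' col_sym[of p a] ne abc by auto
    have "R q p \<longleftrightarrow> R q p'" using minority[of q p p'] S' ne p' col_sym[of p q] by auto
    hence 1: "R p' q" using S' total[of p q] total[of q p'] ne p' by auto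
    have 2: "col a p' = k"
    proof (rule ccontr)
      assume "col a p' \<noteq> k"
      hence "R q a \<longleftrightarrow> R q p'"
        using minority[of q a p'] S' ne p' \<open>p' \<noteq> a\<close> abc col_sym[of q a] by auto
      thus False using 1 S' total[of q p'] p' by auto
    qed
    have "R a p \<longleftrightarrow> R a p'" using minority[of a p p'] 2 S' ne p' \<open>p' \<noteq> a\<close> abc by auto
    thus ?thesis using 1 2 S' p' col_sym[of p' q] by (auto simp: S_def)
  qed
  \<comment> \<open>Arcs of \<open>S\<close> are taken without direction, so that \<open>M\<close>
    is the vertex set of the component of \<open>b c\<close>.\<close>
  define E where "E = S \<union> S\<inverse>"
  define M where "M = {v. (b, v) \<in> E\<^sup>*}"
  have ne: "a \<noteq> b" "b \<noteq> c" "a \<noteq> c" using abc irrefl by auto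
  have bc: "(b, c) \<in> S"
    using abc cycle_mono[of a b c] cycle_mono[of b c a] col_sym[of a c] ne by (auto simp: S_def k_def)
  have Mab: "M \<subseteq> V - {a}"
  proof
    fix v assume "v \<in> M"
    hence "(b, v) \<in> E\<^sup>*" by (simp add: M_def)
    thus "v \<in> V - {a}" by (induction) (use abc ne irrefl in \<open>auto simp: E_def S_def\<close>)
  qed
  \<comment> \<open>A vertex that tells the ends of an arc of \<open>S\<close> apart by colour is
    joined to exactly one of them in colour \<open>k\<close>; \<open>tl\<close> or \<open>hd\<close>
    then puts it on an arc of \<open>S\<close> with that end, hence into \<open>M\<close>.\<close>
  have edge: "col u p = col u q" if u: "u \<in> V - M" and pq: "p \<in> M" "(p, q) \<in> S \<or> (q, p) \<in> S" for u p q
  proof (rule ccontr)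
    assume diff: "col u p \<noteq> col u q"
    have qM: "q \<in> M" using pq by (auto simp: M_def E_def intro: rtrancl_into_rtrancl)
    have dist: "u \<noteq> p" "u \<noteq> q" "p \<in> V" "q \<in> V" using u pq(1) qM Mab by auto
    have sy: "col u p = col p u" "col u q = col q u" using dist u col_sym[of u p] col_sym[of u q] by auto
    have "col p u = k \<and> col q u \<noteq> k \<or> col q u = k \<and> col p u \<noteq> k" using diff sy by blast
    hence "(p, u) \<in> S \<or> (u, p) \<in> S \<or> (q, u) \<in> S \<or> (u, q) \<in> S"
      using pq(2) tl[of p q u] hd[of p q u] tl[of q p u] hd[of q p u] dist(1,2) u by blast
    hence "u \<in> M" using pq(1) qM by (auto simp: M_def E_def intro: rtrancl_into_rtrancl)
    thus False using u by simp
  qed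
  have "col u b = col u v" if u: "u \<in> V - M" and v: "v \<in> M" for u v
  proof -
    have "(b, v) \<in> E\<^sup>*" using v by (simp add: M_def)
    thus ?thesis
    proof (induction)
      case (step y z)
      thus ?case using edge[OF u, of y z] by (auto simp: M_def E_def)
    qed simp
  qed
  hence "colour_module M" using Mab unfolding colour_module_def by blast
  hence "card M \<le> 1" by (rule colour_module_trivial[OF both]) (use Mab abc in auto)
  moreover have "b \<in> M" "c \<in> M" using bc by (auto simp: M_def E_def)
  moreover have "finite M" using Mab finite_V by (meson finite_Diff finite_subset)
  ultimately show False using ne(2) by (metis One_nat_def card_le_Suc0_iff_eq)
qed

end

section \<open>Three-cycles, duals and modules of tournaments\<close>

definition dual :: "'a pair_pre_digraph \<Rightarrow> 'a pair_pre_digraph" where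
  "dual T = \<lparr>pverts = pverts T, parcs = (parcs T)\<inverse>\<rparr>"

definition cyclic :: "'a pair_pre_digraph \<Rightarrow> 'a \<Rightarrow> 'a \<Rightarrow> 'a \<Rightarrow> bool" where
  "cyclic T a b c \<longleftrightarrow> (a, b) \<in> parcs T \<and> (b, c) \<in> parcs T \<and> (c, a) \<in> parcs T"

text \<open>Comparing the arcs that enter \<open>M\<close> is enough, since in a tournament they
  determine the arcs that leave it.\<close>

definition arc_module :: "'a pair_pre_digraph \<Rightarrow> 'a set \<Rightarrow> bool" where
  "arc_module T M \<longleftrightarrow> M \<subseteq> pverts T \<and>
    (\<forall>u\<in>pverts T - M. \<forall>m\<in>M. \<forall>n\<in>M. (u, m) \<in> parcs T \<longleftrightarrow> (u, n) \<in> parcs T)"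

lemma tournament_iff:
  "tournament T \<longleftrightarrow> finite (pverts T) \<and> parcs T \<subseteq> pverts T \<times> pverts T \<and> (\<forall>v. (v, v) \<notin> parcs T) \<and>
    (\<forall>v\<in>pverts T. \<forall>w\<in>pverts T. v \<noteq> w \<longrightarrow> ((v, w) \<in> parcs T \<longleftrightarrow> (w, v) \<notin> parcs T))"
  (is "?L \<longleftrightarrow> ?R")
proof
  assume L: ?L
  then interpret pair_digraph T by (simp add: tournament_def)
  have "parcs T \<subseteq> pverts T \<times> pverts T" using in_arcsD1 in_arcsD2 by auto
  moreover have "(v, v) \<notin> parcs T" for v using pair_no_loops by fastforce
  ultimately show ?R using L pair_finite_verts unfolding tournament_def by blast
next
  assume R: ?R
  have "finite (parcs T)" using R by (metis finite_SigmaI finite_subset)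
  moreover have "fst e \<in> pverts T" "snd e \<in> pverts T" "fst e \<noteq> snd e" if "e \<in> parcs T" for e
  proof -
    obtain v w where "e = (v, w)" by (cases e)
    thus "fst e \<in> pverts T" "snd e \<in> pverts T" "fst e \<noteq> snd e" using that R by auto
  qed
  ultimately have "pair_digraph T"
    using R by unfold_locales blast+
  thus ?L using R unfolding tournament_def by blast
qed

lemma tournamentD:
  assumes "tournament T"
  shows tournament_finite: "finite (pverts T)"
    and tournament_verts: "(v, w) \<in> parcs T \<Longrightarrow> v \<in> pverts T \<and> w \<in> pverts T \<and> v \<noteq> w"
    and tournament_asym: "(v, w) \<in> parcs T \<Longrightarrow> (w, v) \<notin> parcs T"
    and tournament_total: "\<lbrakk>v \<in> pverts T; w \<in> pverts T; v \<noteq> w\<rbrakk> \<Longrightarrow> (v, w) \<in> parcs T \<or> (w, v) \<in> parcs T"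
proof -
  have fin: "finite (pverts T)" and sub: "parcs T \<subseteq> pverts T \<times> pverts T"
    and loop: "\<And>v. (v, v) \<notin> parcs T"
    and tot: "\<And>v w. v \<in> pverts T \<Longrightarrow> w \<in> pverts T \<Longrightarrow> v \<noteq> w \<Longrightarrow> (v, w) \<in> parcs T \<longleftrightarrow> (w, v) \<notin> parcs T"
    using assms unfolding tournament_iff by (elim conjE; assumption | blast)+
  show "finite (pverts T)" by (rule fin)
  show ends: "(v, w) \<in> parcs T \<Longrightarrow> v \<in> pverts T \<and> w \<in> pverts T \<and> v \<noteq> w" for v w
    using sub loop by (metis SigmaD1 SigmaD2 subsetD)
  show "(v, w) \<in> parcs T \<Longrightarrow> (w, v) \<notin> parcs T"
    using ends[of v w] tot[of v w] by simp
  show "\<lbrakk>v \<in> pverts T; w \<in> pverts T; v \<noteq> w\<rbrakk> \<Longrightarrow> (v, w) \<in> parcs T \<or> (w, v) \<in> parcs T"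
    using tot[of v w] by simp
qed

lemma cyclicD:
  assumes "tournament T" "cyclic T a b c"
  shows "{a, b, c} \<subseteq> pverts T" "a \<noteq> b" "b \<noteq> c" "a \<noteq> c"
  using assms tournament_verts[OF assms(1)] unfolding cyclic_def by blast+

lemma tournament_dual: "tournament T \<Longrightarrow> tournament (dual T)"
  unfolding tournament_iff dual_def pair_pre_digraph.simps by blast

lemma cyclic_dual: "cyclic (dual T) a b c \<longleftrightarrow> cyclic T b a c"
  by (auto simp: cyclic_def dual_def)

text \<open>Replaces the isomorphism in the definition of \<open>C3\<close> by an explicit
  orientation, so that later arguments only handle \<open>cyclic\<close>.\<close>

lemma restrict_three_cycle_iff:
  assumes T: "tournament T" and X: "X \<subseteq> pverts T"
  shows "digraph_iso (with_proj T \<restriction> X) (with_proj three_cycle) \<longleftrightarrow>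
    (\<exists>a b c. X = {a, b, c} \<and> cyclic T a b c)" (is "?L \<longleftrightarrow> ?R")
proof
  let ?G = "with_proj T \<restriction> X"
  have sG: "verts ?G = X" "arcs ?G = {e \<in> parcs T. fst e \<in> X \<and> snd e \<in> X}" "tail ?G = fst" "head ?G = snd"
    by (simp_all add: induce_subgraph_def with_proj_def)
  {
    assume ?L
    then obtain f where f: "pre_digraph.digraph_isomorphism ?G f" and eq: "with_proj three_cycle = app_iso f ?G"
      by (auto simp: digraph_iso_def)
    have V: "{0, 1, 2} = iso_verts f ` X" and A: "{(0,1),(1,2),(2,0)} = iso_arcs f ` arcs ?G"
      and t: "iso_tail f = fst" "iso_head f = snd"
      using eq by (auto simp: app_iso_def with_proj_def three_cycle_def sG)
    have inj: "inj_on (iso_verts f) X"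
      and ends: "\<And>e. e \<in> arcs ?G \<Longrightarrow> iso_arcs f e = (iso_verts f (fst e), iso_verts f (snd e))"
      using f t unfolding pre_digraph.digraph_isomorphism_def sG by (auto simp: prod_eq_iff)
    obtain a where a: "a \<in> X" "iso_verts f a = 0" using V by (metis imageE insertI1)
    obtain b where b: "b \<in> X" "iso_verts f b = 1" using V by (metis imageE insertI1 insertI2)
    obtain c where c: "c \<in> X" "iso_verts f c = 2" using V by (metis imageE insertI1 insertI2)
    have "X = {a, b, c}"
    proof
      show "X \<subseteq> {a, b, c}"
      proof
        fix y assume y: "y \<in> X"
        hence "iso_verts f y \<in> {0, 1, 2}" using V by blast
        thus "y \<in> {a, b, c}"
          using inj_onD[OF inj _ y a(1)] inj_onD[OF inj _ y b(1)] inj_onD[OF inj _ y c(1)] a(2) b(2) c(2)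
          by auto
      qed
    qed (use a b c in auto)
    moreover have arc: "(p, q) \<in> parcs T"
      if ij: "(iso_verts f p, iso_verts f q) \<in> {(0,1),(1,2),(2,0)}" and pq: "p \<in> X" "q \<in> X" for p q
    proof -
      obtain e where e: "e \<in> arcs ?G" "(iso_verts f p, iso_verts f q) = iso_arcs f e"
        using ij unfolding A by blast
      moreover have "fst e \<in> X" "snd e \<in> X" using e(1) sG by auto
      ultimately have "fst e = p" "snd e = q" using ends[OF e(1)] inj_onD[OF inj] pq by auto
      thus ?thesis using e(1) sG by auto
    qed
    hence "cyclic T a b c" using a b c by (simp add: cyclic_def)
    ultimately show ?R by blast
  }
  assume ?R
  then obtain a b c where abc: "X = {a, b, c}" "cyclic T a b c" by blast
  have ne: "a \<noteq> b" "b \<noteq> c" "a \<noteq> c" using cyclicD[OF T abc(2)] by simp_all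
  have arcsG: "arcs ?G = {(a, b), (b, c), (c, a)}"
  proof -
    have "(a, b) \<in> parcs T" "(b, c) \<in> parcs T" "(c, a) \<in> parcs T"
      using abc(2) by (auto simp: cyclic_def)
    moreover from this have "(b, a) \<notin> parcs T" "(c, b) \<notin> parcs T" "(a, c) \<notin> parcs T"
      using tournament_asym[OF T] by blast+
    moreover have "(v, v) \<notin> parcs T" for v using tournament_verts[OF T] by blast
    ultimately show ?thesis unfolding sG abc(1) by auto
  qed
  \<comment> \<open>The value 2 is that of \<open>c\<close> and also the default outside
    \<open>X\<close>.\<close>
  define g where "g v = (if v = a then 0 else if v = b then 1 else 2 :: nat)" for v
  let ?f = "\<lparr>iso_verts = g, iso_arcs = map_prod g g, iso_head = snd, iso_tail = fst\<rparr>"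
  have "wf_digraph ?G" by unfold_locales (auto simp: sG)
  hence "pre_digraph.digraph_isomorphism ?G ?f"
    unfolding pre_digraph.digraph_isomorphism_def arcsG
    using ne by (auto simp: sG abc inj_on_def g_def)
  moreover have "with_proj three_cycle = app_iso ?f ?G"
    unfolding app_iso_def arcsG unfolding sG(1) abc(1)
    using ne by (auto simp: with_proj_def three_cycle_def g_def)
  ultimately show ?L unfolding digraph_iso_def by blast
qed

lemma hverts_C3: "hverts (C3 T) = pverts T"
  by (simp add: C3_def)

lemma hedges_C3:
  assumes T: "tournament T"
  shows "X \<in> hedges (C3 T) \<longleftrightarrow> (\<exists>a b c. X = {a, b, c} \<and> cyclic T a b c)"
proof -
  have "X \<subseteq> pverts T" "card X = 3" if "X = {a, b, c}" "cyclic T a b c" for a b c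
    using cyclicD[OF T that(2)] that(1) by simp_all
  thus ?thesis using restrict_three_cycle_iff[OF T, of X] by (auto simp: C3_def)
qed

text \<open>\<open>cyclic\<close> is invariant under rotation, so the six orders of a triple fall
  into two classes, represented by \<open>a b c\<close> and \<open>b a c\<close>.\<close>

lemma triple_in_hedges_C3:
  assumes T: "tournament T"
  shows "{a, b, c} \<in> hedges (C3 T) \<longleftrightarrow> cyclic T a b c \<or> cyclic T b a c"
proof
  assume "{a, b, c} \<in> hedges (C3 T)"
  then obtain p q r where pqr: "{a, b, c} = {p, q, r}" "cyclic T p q r"
    using hedges_C3[OF T] by auto
  moreover have ne: "p \<noteq> q" "q \<noteq> r" "p \<noteq> r" using cyclicD[OF T pqr(2)] by simp_all
  moreover have "(a = p \<and> b = q \<and> c = r) \<or> (a = p \<and> b = r \<and> c = q) \<or> (a = q \<and> b = p \<and> c = r) \<or>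
    (a = q \<and> b = r \<and> c = p) \<or> (a = r \<and> b = p \<and> c = q) \<or> (a = r \<and> b = q \<and> c = p)"
  proof -
    have "a \<in> {p, q, r}" "b \<in> {p, q, r}" "c \<in> {p, q, r}" "p \<in> {a, b, c}" "q \<in> {a, b, c}" "r \<in> {a, b, c}"
      using pqr(1) by blast+
    thus ?thesis using ne by auto
  qed
  ultimately show "cyclic T a b c \<or> cyclic T b a c" unfolding cyclic_def by blast
next
  assume "cyclic T a b c \<or> cyclic T b a c"
  thus "{a, b, c} \<in> hedges (C3 T)" unfolding hedges_C3[OF T] by (metis insert_commute)
qed

lemma hedges_C3_mono:
  assumes "tournament T" "tournament T'"
    and "\<And>a b c. cyclic T a b c \<Longrightarrow> cyclic T' a b c \<or> cyclic T' b a c"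
  shows "hedges (C3 T) \<subseteq> hedges (C3 T')"
proof
  fix e assume "e \<in> hedges (C3 T)"
  then obtain a b c where "e = {a, b, c}" "cyclic T a b c"
    unfolding hedges_C3[OF assms(1)] by blast
  thus "e \<in> hedges (C3 T')" using triple_in_hedges_C3[OF assms(2)] assms(3) by metis
qed

lemma C3_dual:
  assumes "tournament T"
  shows "C3 (dual T) = C3 T"
proof (rule hypergraph.equality)
  show "hedges (C3 (dual T)) = hedges (C3 T)"
    using tournament_dual[OF assms] assms
    by (intro subset_antisym hedges_C3_mono) (auto simp: cyclic_dual)
qed (simp_all add: hverts_C3 dual_def)

lemma realization_dual:
  assumes "realization T H"
  shows "realization (dual T) H"
proof -
  have T: "tournament T" using assms unfolding realization_def by blast
  moreover have "pverts (dual T) = pverts T" by (simp add: dual_def)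
  ultimately show ?thesis using assms tournament_dual[OF T] C3_dual[OF T]
    unfolding realization_def by metis
qed

text \<open>A three-cycle that meets \<open>M\<close> without being contained in it has an arc from
  some \<open>a\<close> in \<open>M\<close> to some \<open>b\<close> outside. The third vertex
  \<open>c\<close> is not in \<open>M\<close>, since \<open>b\<close> would dominate
  \<open>c\<close> but not \<open>a\<close>. So the cycle meets \<open>M\<close> in \<open>a\<close>
  alone, and any vertex of \<open>M\<close> can replace \<open>a\<close>.\<close>

lemma arc_module_is_module:
  assumes T: "tournament T" and M: "arc_module T M"
  shows "is_module (C3 T) M"
  unfolding is_module_def
proof (intro conjI ballI impI)
  show "M \<subseteq> hverts (C3 T)" using M unfolding hverts_C3 arc_module_def by blast
  fix e assume e: "e \<in> hedges (C3 T)" and meets: "e \<inter> M \<noteq> {} \<and> e - M \<noteq> {}"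
  obtain p q r where pqr: "e = {p, q, r}" "cyclic T p q r"
    using e hedges_C3[OF T] by auto
  have M_out: "(u, m) \<in> parcs T \<longleftrightarrow> (u, n) \<in> parcs T"
    and M_in: "(m, u) \<in> parcs T \<longleftrightarrow> (n, u) \<in> parcs T"
    if "u \<in> pverts T - M" "m \<in> M" "n \<in> M" for u m n
    using M that tournament_total[OF T] tournament_asym[OF T] unfolding arc_module_def by blast+
  have *: "\<exists>m\<in>M. e \<inter> M = {m} \<and> (\<forall>n\<in>M. e - {m} \<union> {n} \<in> hedges (C3 T))"
    if abc: "e = {a, b, c}" "cyclic T a b c" "a \<in> M" "b \<notin> M" for a b c
  proof -
    have v: "b \<in> pverts T" "c \<in> pverts T" "a \<noteq> b" "a \<noteq> c" "b \<noteq> c"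
      using abc tournament_verts[OF T] unfolding cyclic_def by blast+
    have "c \<notin> M"
      using M_in[of b a c] abc v tournament_asym[OF T] unfolding cyclic_def by blast
    moreover have "cyclic T n b c" if "n \<in> M" for n
      using abc v that \<open>c \<notin> M\<close> M_in[of b a n] M_out[of c a n] unfolding cyclic_def by blast
    moreover have "e - {a} = {b, c}" using abc v by auto
    ultimately show ?thesis
      using abc triple_in_hedges_C3[OF T] by (intro bexI[of _ a]) auto
  qed
  \<comment> \<open>Going around the cycle, some arc leaves \<open>M\<close>; rotating the triple
    brings it to the front.\<close>
  have "p \<in> M \<and> q \<notin> M \<or> q \<in> M \<and> r \<notin> M \<or> r \<in> M \<and> p \<notin> M" using meets pqr by auto
  thus "\<exists>m\<in>M. e \<inter> M = {m} \<and> (\<forall>n\<in>M. e - {m} \<union> {n} \<in> hedges (C3 T))"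
  proof (elim disjE conjE)
    assume "p \<in> M" "q \<notin> M" thus ?thesis using *[of p q r] pqr by blast
  next
    assume "q \<in> M" "r \<notin> M" thus ?thesis using *[of q r p] pqr by (auto simp: cyclic_def insert_commute)
  next
    assume "r \<in> M" "p \<notin> M" thus ?thesis using *[of r p q] pqr by (auto simp: cyclic_def insert_commute)
  qed
qed

section \<open>Uniqueness of the realization up to duality\<close>

lemma prime_arc_module_trivial:
  assumes "realization T H" "prime_hypergraph H" "arc_module T M"
  shows "M = {} \<or> M = hverts H \<or> (\<exists>v. M = {v})"
proof -
  have "is_module H M" using assms(1,3) arc_module_is_module[of T M] by (metis realization_def)
  hence "trivial_module H M" using assms(2) by (simp add: prime_hypergraph_def)
  thus ?thesis unfolding trivial_module_def by blast
qed

text \<open>Without edges every set of vertices is a module, in particular the complement of a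
  vertex. The edge supplies the three-cycle from which \<open>monochromatic\<close> starts.\<close>

lemma prime_hypergraph_has_edge:
  assumes "prime_hypergraph H"
  shows "hedges H \<noteq> {}"
proof
  assume "hedges H = {}"
  have "\<not> hverts H \<subseteq> {}" using assms by (auto simp: prime_hypergraph_def)
  then obtain v where v: "v \<in> hverts H" by blast
  have "is_module H (hverts H - {v})" using \<open>hedges H = {}\<close> by (simp add: is_module_def)
  hence "trivial_module H (hverts H - {v})" using assms by (simp add: prime_hypergraph_def)
  moreover have "card (hverts H - {v}) \<ge> 2"
    using assms card_Diff_singleton[OF v] unfolding prime_hypergraph_def by linarith
  moreover have "hverts H - {v} \<noteq> hverts H" using v by blast
  moreover have "\<not> card {u} \<ge> 2" "\<not> card {} \<ge> 2" for u :: 'a by simp_all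
  ultimately show False unfolding trivial_module_def by metis
qed

theorem prime_realization_unique_up_to_dual:
  assumes prime: "prime_hypergraph H" and R: "realization T H" and R': "realization T' H"
  shows "T' = T \<or> T' = dual T"
proof -
  have T: "tournament T" and T': "tournament T'" and V: "pverts T = hverts H" "pverts T' = hverts H"
    and eq: "C3 T = C3 T'" and H: "H = C3 T"
    using R R' by (auto simp: realization_def)
  have cyc: "cyclic T a b c \<or> cyclic T b a c \<longleftrightarrow> cyclic T' a b c \<or> cyclic T' b a c" for a b c
    using eq triple_in_hedges_C3[OF T] triple_in_hedges_C3[OF T'] by metis
  define agree where "agree u v \<longleftrightarrow> ((u, v) \<in> parcs T \<longleftrightarrow> (u, v) \<in> parcs T')" for u v
  have flip: "(u, v) \<in> parcs S \<longleftrightarrow> (v, u) \<notin> parcs S"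
    if "u \<in> hverts H" "v \<in> hverts H" "u \<noteq> v" "S = T \<or> S = T'" for u v S
    using that tournament_total[OF T, of u v] tournament_asym[OF T, of u v]
      tournament_total[OF T', of u v] tournament_asym[OF T', of u v] V by auto
  interpret ct: coloured_tournament "hverts H" "\<lambda>u v. (u, v) \<in> parcs T" agree
  proof
    show "finite (hverts H)" using tournament_finite[OF T] V by simp
    show "(u, u) \<notin> parcs T" for u using tournament_verts[OF T] by blast
    show "(u, v) \<in> parcs T \<longleftrightarrow> (v, u) \<notin> parcs T"
      if "u \<in> hverts H" "v \<in> hverts H" "u \<noteq> v" for u v
      using flip that by blast
    show "agree u v = agree v u" if "u \<in> hverts H" "v \<in> hverts H" "u \<noteq> v" for u v
      using that flip[of u v T] flip[of u v T'] by (auto simp: agree_def)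
    \<comment> \<open>A three-cycle of \<open>T\<close> is traversed in \<open>T'\<close> in the
      same or in the opposite direction, so its pairs all agree or all disagree.\<close>
    show "agree u v = agree v w"
      if "u \<in> hverts H" "v \<in> hverts H" "w \<in> hverts H" "(u, v) \<in> parcs T" "(v, w) \<in> parcs T" "(w, u) \<in> parcs T"
      for u v w
      using that(4-6) cyc[of u v w] tournament_asym[OF T'] unfolding agree_def cyclic_def by blast
    \<comment> \<open>If \<open>u\<close> dominated exactly one of \<open>v\<close> and
      \<open>w\<close>, then reversing the arc between them, or reversing both arcs at
      \<open>u\<close>, would exchange a transitive triple and a three-cycle, contrary to
      \<open>cyc\<close>.\<close>
    show "(u, v) \<in> parcs T \<longleftrightarrow> (u, w) \<in> parcs T"
      if "u \<in> hverts H" "v \<in> hverts H" "w \<in> hverts H" "u \<noteq> v" "u \<noteq> w" "v \<noteq> w"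
        "agree u v = agree u w" "agree u v \<noteq> agree v w" for u v w
    proof -
      have f: "(v, u) \<in> parcs T \<longleftrightarrow> (u, v) \<notin> parcs T" "(v, u) \<in> parcs T' \<longleftrightarrow> (u, v) \<notin> parcs T'"
        "(w, u) \<in> parcs T \<longleftrightarrow> (u, w) \<notin> parcs T" "(w, u) \<in> parcs T' \<longleftrightarrow> (u, w) \<notin> parcs T'"
        "(w, v) \<in> parcs T \<longleftrightarrow> (v, w) \<notin> parcs T" "(w, v) \<in> parcs T' \<longleftrightarrow> (v, w) \<notin> parcs T'"
        using that(1-6) flip by blast+
      show ?thesis
        using that(7,8) cyc[of u v w] unfolding agree_def cyclic_def f by blast
    qed
    show "card M \<le> 1 \<or> M = hverts H"
      if "M \<subseteq> hverts H" "\<And>u m n. \<lbrakk>u \<in> hverts H - M; m \<in> M; n \<in> M\<rbrakk> \<Longrightarrow> (u, m) \<in> parcs T \<longleftrightarrow> (u, n) \<in> parcs T"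
      for M
    proof -
      have "arc_module T M" using that unfolding arc_module_def V by blast
      thus ?thesis using prime_arc_module_trivial[OF R prime] by force
    qed
  qed
  obtain e where "e \<in> hedges H" using prime_hypergraph_has_edge[OF prime] by blast
  then obtain a b c where "cyclic T a b c" using hedges_C3[OF T] H by auto
  then obtain k where k: "\<And>u v. \<lbrakk>u \<in> hverts H; v \<in> hverts H; u \<noteq> v\<rbrakk> \<Longrightarrow> agree u v = k"
    using ct.monochromatic[of a b c] tournament_verts[OF T] V unfolding cyclic_def by metis
  have iff: "(u, v) \<in> parcs T' \<longleftrightarrow> (if k then (u, v) \<in> parcs T else (v, u) \<in> parcs T)" for u v
  proof (cases "u \<in> hverts H \<and> v \<in> hverts H \<and> u \<noteq> v")
    case True
    thus ?thesis using k[of u v] flip[of u v T] by (auto simp: agree_def)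
  next
    case False
    hence "(u, v) \<notin> parcs T" "(v, u) \<notin> parcs T" "(u, v) \<notin> parcs T'"
      using tournament_verts[OF T] tournament_verts[OF T'] V by blast+
    thus ?thesis by simp
  qed
  show ?thesis
  proof (cases k)
    case True
    hence "parcs T' = parcs T" using iff by auto
    thus ?thesis using V by simp
  next
    case False
    hence "parcs T' = parcs (dual T)" using iff by (auto simp: dual_def)
    thus ?thesis using V by (simp add: dual_def)
  qed
qed

section \<open>Link graphs and extension by a vertex\<close>

lemma bipartition_iff:
  "bipartition S A B \<longleftrightarrow> A \<union> B = S \<and> A \<inter> B = {} \<and> A \<noteq> {} \<and> B \<noteq> {}"
  unfolding bipartition_def partition_on_def disjoint_def by auto

text \<open>Carries facts about \<open>Y_minus\<close> over to \<open>Y_plus\<close> by reversing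
  all arcs.\<close>

lemma Y_plus_eq: "Y_plus T I X = Y_minus (dual T) I X"
  by (simp add: Y_plus_def Y_minus_def dual_def)

lemma Y_minus_subset: "Y_minus T I X \<subseteq> I"
  by (auto simp: Y_minus_def)

lemma Y_minus_start:
  assumes "u \<in> X" "v \<in> I" "(u, v) \<in> parcs T"
  shows "v \<in> Y_minus T I X"
proof -
  let ?s = "\<lambda>i::nat. if i = 0 then u else v"
  have "?s 0 \<in> X \<and> ?s 1 = v \<and> (\<forall>i\<in>{1..1}. ?s i \<in> I) \<and> (\<forall>i<1. (?s i, ?s (Suc i)) \<in> parcs T)"
    using assms by simp
  thus ?thesis using assms(2) unfolding Y_minus_def
    by (intro CollectI conjI exI[of _ 1] exI[of _ ?s]) (assumption | blast)+
qed

lemma Y_minus_step: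
  assumes "u \<in> Y_minus T I X" "v \<in> I" "(u, v) \<in> parcs T"
  shows "v \<in> Y_minus T I X"
proof -
  obtain n s where s: "s 0 \<in> X" "s n = u" "\<forall>i\<in>{1..n}. s i \<in> I" "\<forall>i<n. (s i, s (Suc i)) \<in> parcs T"
    using assms(1) unfolding Y_minus_def by blast
  let ?s = "s(Suc n := v)"
  have "?s 0 \<in> X \<and> ?s (Suc n) = v \<and> (\<forall>i\<in>{1..Suc n}. ?s i \<in> I) \<and>
    (\<forall>i<Suc n. (?s i, ?s (Suc i)) \<in> parcs T)"
    using s assms(2,3) by (auto simp: less_Suc_eq)
  thus ?thesis using assms(2) unfolding Y_minus_def
    by (intro CollectI conjI exI[of _ "Suc n"] exI[of _ ?s]) (assumption | blast)+
qed

text \<open>\<open>P\<close> has to cover \<open>X\<close> as well: the first vertex of a walk is in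
  \<open>X\<close> and need not be in \<open>I\<close>.\<close>

lemma Y_minus_induct [consumes 1, case_names start step]:
  assumes "v \<in> Y_minus T I X"
    and "\<And>u. u \<in> X \<Longrightarrow> P u"
    and "\<And>u v. \<lbrakk>P u; v \<in> I; (u, v) \<in> parcs T\<rbrakk> \<Longrightarrow> P v"
  shows "P v"
proof -
  obtain n s where s: "s 0 \<in> X" "s n = v" "\<forall>i\<in>{1..n}. s i \<in> I" "\<forall>i<n. (s i, s (Suc i)) \<in> parcs T"
    using assms(1) unfolding Y_minus_def by blast
  have "i \<le> n \<Longrightarrow> P (s i)" for i
  proof (induction i)
    case 0 thus ?case using assms(2) s(1) by simp
  next
    case (Suc i)
    thus ?case using assms(3)[of "s i" "s (Suc i)"] s(3,4) by simp
  qed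
  thus ?thesis using s(2) by blast
qed

text \<open>By finiteness, a connected subgraph of greatest size among those containing the arc is a
  component. Size counts vertices and arcs together because maximality of a subgraph concerns
  both.\<close>

lemma component_of_arc:
  assumes G: "pair_fin_digraph G" and vw: "(v, w) \<in> parcs G"
  obtains C where "is_component (with_proj G) C" "(v, w) \<in> arcs C" "{v, w} \<subseteq> verts C"
proof -
  interpret pair_fin_digraph G by (rule G)
  define P where "P C \<longleftrightarrow> subgraph C (with_proj G) \<and> connected C \<and> (v, w) \<in> arcs C"
    for C :: "('a, 'a \<times> 'a) pre_digraph"
  define sz where "sz C = card (verts C) + card (arcs C)" for C :: "('a, 'a \<times> 'a) pre_digraph"
  \<comment> \<open>A single arc with its two ends is connected, since connectedness is taken after
    adding the reversed arcs.\<close>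
  define C0 where "C0 = \<lparr>verts = {v, w}, arcs = {(v, w)}, tail = fst, head = snd\<rparr>"
  have "connected C0"
    unfolding connected_def
  proof
    show "verts (with_proj (mk_symmetric C0)) \<noteq> {}" by (simp add: mk_symmetric_def C0_def)
    fix p q assume "p \<in> verts (with_proj (mk_symmetric C0))" "q \<in> verts (with_proj (mk_symmetric C0))"
    thus "p \<rightarrow>\<^sup>*\<^bsub>with_proj (mk_symmetric C0)\<^esub> q"
      by (auto simp: mk_symmetric_def C0_def reachable_def
          intro: rtrancl_on_refl rtrancl_on_into_rtrancl_on[OF rtrancl_on_refl])
  qed
  moreover have "subgraph C0 (with_proj G)"
    unfolding subgraph_def using vw in_arcsD1 in_arcsD2 wf_digraph_axioms
    by (auto simp: C0_def compatible_def wf_digraph_def)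
  ultimately have "P C0" by (simp add: P_def C0_def)
  have fin: "finite (verts C)" "finite (arcs C)" if "subgraph C (with_proj G)" for C
    using that pair_finite_verts pair_finite_arcs finite_subset
    unfolding subgraph_def by (auto dest: finite_subset)
  have bound: "sz C < Suc (sz (with_proj G))" if "P C" for C
    using that pair_finite_verts pair_finite_arcs unfolding P_def subgraph_def sz_def
    by (auto simp: less_Suc_eq_le intro!: add_mono card_mono)
  obtain C where C: "P C" and mx: "\<And>C'. P C' \<Longrightarrow> sz C' \<le> sz C"
    using ex_has_greatest_nat[of P C0 sz "Suc (sz (with_proj G))"] \<open>P C0\<close> bound
    by (metis less_imp_le_nat)
  have sub: "subgraph C (with_proj G)" using C by (simp add: P_def)
  have "C' = C" if sub': "subgraph C C'" "subgraph C' (with_proj G)" and con: "connected C'" for C'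
  proof -
    have inc: "verts C \<subseteq> verts C'" "arcs C \<subseteq> arcs C'" and comp: "tail C' = tail C" "head C' = head C"
      using sub'(1) unfolding subgraph_def compatible_def by blast+
    have "P C'" using C inc(2) sub'(2) con unfolding P_def by blast
    hence "sz C' \<le> sz C" by (rule mx)
    moreover have "card (verts C) \<le> card (verts C')" "card (arcs C) \<le> card (arcs C')"
      using inc fin[OF sub'(2)] by (auto intro: card_mono)
    ultimately have "card (verts C') \<le> card (verts C)" "card (arcs C') \<le> card (arcs C)"
      unfolding sz_def by linarith+
    hence "verts C = verts C'" "arcs C = arcs C'"
      using inc fin[OF sub'(2)] card_seteq by blast+
    thus ?thesis using comp by (intro pre_digraph.equality) simp_all
  qed
  hence "is_component (with_proj G) C"
    using C sub unfolding is_component_def pre_digraph.max_subgraph_def P_def by blast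
  moreover have arc: "(v, w) \<in> arcs C" using C by (simp add: P_def)
  moreover have "{v, w} \<subseteq> verts C"
    using sub arc unfolding subgraph_def wf_digraph_def compatible_def by fastforce
  ultimately show ?thesis by (rule that)
qed

lemma componentD:
  assumes "is_component (with_proj G) C"
  shows "verts C \<subseteq> pverts G" "arcs C \<subseteq> parcs G" "tail C = fst" "head C = snd"
    "e \<in> arcs C \<Longrightarrow> fst e \<in> verts C \<and> snd e \<in> verts C"
proof -
  have sub: "verts C \<subseteq> pverts G" "arcs C \<subseteq> parcs G" "wf_digraph C"
    and th: "tail C = fst" "head C = snd"
    using assms unfolding is_component_def pre_digraph.max_subgraph_def subgraph_def compatible_def
    by auto
  show "verts C \<subseteq> pverts G" "arcs C \<subseteq> parcs G" "tail C = fst" "head C = snd"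
    by (fact sub(1) sub(2) th)+
  show "e \<in> arcs C \<Longrightarrow> fst e \<in> verts C \<and> snd e \<in> verts C"
    using sub(3) th unfolding wf_digraph_def by metis
qed

text \<open>A walk from \<open>v\<close> to another vertex starts with an arc at \<open>v\<close>.
  The walk runs in the symmetric closure, hence the two directions in the conclusion.\<close>

lemma component_vertex_not_isolated:
  assumes C: "is_component (with_proj G) C" and card: "card (verts C) \<ge> 2" and v: "v \<in> verts C"
  obtains w where "(v, w) \<in> arcs C \<or> (w, v) \<in> arcs C"
proof -
  have "\<not> verts C \<subseteq> {v}"
  proof
    assume "verts C \<subseteq> {v}"
    hence "card (verts C) \<le> card {v}" by (intro card_mono) auto
    thus False using card by simp
  qed
  then obtain u where u: "u \<in> verts C" "u \<noteq> v" by blast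
  have "connected C" using C unfolding is_component_def pre_digraph.max_subgraph_def by blast
  hence "v \<rightarrow>\<^sup>*\<^bsub>with_proj (mk_symmetric C)\<^esub> u"
    using u v unfolding connected_def strongly_connected_def by (simp add: mk_symmetric_def)
  hence "(v, u) \<in> rtrancl_on (verts C) (parcs (mk_symmetric C))"
    by (simp add: reachable_def mk_symmetric_def)
  then obtain w where "(v, w) \<in> parcs (mk_symmetric C)"
    using u(2) by (metis converse_rtrancl_on_cases)
  hence "(v, w) \<in> arcs C \<or> (w, v) \<in> arcs C"
    using componentD(3,4)[OF C] unfolding mk_symmetric_def by auto
  thus ?thesis by (rule that)
qed

section \<open>Deleting a vertex of a tournament\<close>

definition delete_vertex :: "'a pair_pre_digraph \<Rightarrow> 'a \<Rightarrow> 'a pair_pre_digraph" where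
  "delete_vertex T x = \<lparr>pverts = pverts T - {x}, parcs = {(v, w) \<in> parcs T. v \<noteq> x \<and> w \<noteq> x}\<rparr>"

lemma with_proj_eq_iff: "with_proj T = with_proj T' \<longleftrightarrow> T = T'"
proof
  assume "with_proj T = with_proj T'"
  hence "verts (with_proj T) = verts (with_proj T')" "arcs (with_proj T) = arcs (with_proj T')"
    by simp_all
  thus "T = T'" by (intro pair_pre_digraph.equality) simp_all
qed simp

lemma del_vert_with_proj: "pre_digraph.del_vert (with_proj T) x = with_proj (delete_vertex T x)"
  by (simp add: pre_digraph.del_vert_def delete_vertex_def with_proj_def) auto

lemma in_delete_vertex: "(v, w) \<in> parcs (delete_vertex T x) \<longleftrightarrow> (v, w) \<in> parcs T \<and> v \<noteq> x \<and> w \<noteq> x"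
  by (simp add: delete_vertex_def)

lemma delete_vertex_dual: "delete_vertex (dual T) x = dual (delete_vertex T x)"
  by (auto simp: delete_vertex_def dual_def)

lemma dual_dual: "dual (dual T) = T"
  by (simp add: dual_def)

lemma tournament_delete_vertex:
  assumes T: "tournament T"
  shows "tournament (delete_vertex T x)"
  unfolding tournament_iff
proof (intro conjI ballI allI impI)
  show "finite (pverts (delete_vertex T x))"
    using tournament_finite[OF T] by (simp add: delete_vertex_def)
  show "parcs (delete_vertex T x) \<subseteq> pverts (delete_vertex T x) \<times> pverts (delete_vertex T x)"
    using tournament_verts[OF T] unfolding delete_vertex_def by fastforce
  show "(v, v) \<notin> parcs (delete_vertex T x)" for v
    using tournament_verts[OF T, of v v] by (auto simp: in_delete_vertex)
  show "(v, w) \<in> parcs (delete_vertex T x) \<longleftrightarrow> (w, v) \<notin> parcs (delete_vertex T x)"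
    if "v \<in> pverts (delete_vertex T x)" "w \<in> pverts (delete_vertex T x)" "v \<noteq> w" for v w
    using that tournament_total[OF T, of v w] tournament_asym[OF T, of v w]
    by (auto simp: delete_vertex_def)
qed

lemma realization_delete_vertex:
  assumes R: "realization T H"
  shows "realization (delete_vertex T x) (hdel H x)"
proof -
  have T: "tournament T" and V: "pverts T = hverts H" and H: "H = C3 T"
    using R unfolding realization_def by blast+
  have T': "tournament (delete_vertex T x)" by (rule tournament_delete_vertex[OF T])
  have cyc: "cyclic (delete_vertex T x) a b c \<longleftrightarrow> cyclic T a b c \<and> x \<notin> {a, b, c}" for a b c
    by (auto simp: cyclic_def in_delete_vertex)
  have "e \<in> hedges (hdel H x) \<longleftrightarrow> e \<in> hedges (C3 (delete_vertex T x))" for e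
  proof -
    have "e \<in> hedges (hdel H x) \<longleftrightarrow> e \<in> hedges (C3 T) \<and> e \<subseteq> pverts T - {x}"
      using H V by (simp add: hdel_def)
    also have "\<dots> \<longleftrightarrow> (\<exists>a b c. e = {a, b, c} \<and> cyclic T a b c) \<and> e \<subseteq> pverts T - {x}"
      unfolding hedges_C3[OF T] by blast
    also have "\<dots> \<longleftrightarrow> (\<exists>a b c. e = {a, b, c} \<and> cyclic T a b c \<and> x \<notin> {a, b, c})"
      using cyclicD(1)[OF T] by blast
    finally show ?thesis unfolding hedges_C3[OF T'] cyc .
  qed
  hence "hedges (hdel H x) = hedges (C3 (delete_vertex T x))" by blast
  moreover have "hverts (hdel H x) = hverts (C3 (delete_vertex T x))"
    using V by (simp add: hdel_def hverts_C3 delete_vertex_def)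
  ultimately have "hdel H x = C3 (delete_vertex T x)"
    by (intro hypergraph.equality) simp_all
  thus ?thesis using T' hverts_C3[of "delete_vertex T x"] unfolding realization_def by metis
qed

section \<open>Realizations of \<open>H\<close> that extend \<open>Tx\<close>\<close>

locale vertex_extension =
  fixes H :: "'a hypergraph" and x :: 'a and Tx :: "'a pair_pre_digraph"
  assumes uniform: "three_uniform H"
    and prime: "prime_hypergraph H"
    and x: "x \<in> hverts H"
    and prime_del: "prime_hypergraph (hdel H x)"
    and realization_Tx: "realization Tx (hdel H x)"
begin

abbreviation "W \<equiv> hverts H - {x}"
abbreviation "G \<equiv> link_graph H x"
abbreviation "I \<equiv> isolated_verts G"

text \<open>\<open>splits N\<close> says that letting \<open>x\<close> dominate exactly \<open>N\<close> extends \<open>Tx\<close> to a realization of \<open>H\<close>.\<close>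

definition splits :: "'a set \<Rightarrow> bool" where
  "splits N \<longleftrightarrow> N \<subseteq> W \<and> (\<forall>v\<in>W. \<forall>w\<in>W. (v, w) \<in> parcs G \<longleftrightarrow>
    v \<in> N \<and> w \<notin> N \<and> (v, w) \<in> parcs Tx \<or> w \<in> N \<and> v \<notin> N \<and> (w, v) \<in> parcs Tx)"

lemma Tx: "tournament Tx" and pverts_Tx: "pverts Tx = W" and hdel_eq: "hdel H x = C3 Tx"
  using realization_Tx by (auto simp: realization_def hdel_def)

lemma finite_H: "finite (hverts H)"
  using uniform by (simp add: three_uniform_def)

lemma Tx_flip:
  assumes "v \<in> W" "w \<in> W" "v \<noteq> w"
  shows "(v, w) \<in> parcs Tx \<longleftrightarrow> (w, v) \<notin> parcs Tx"
  using tournament_total[OF Tx, of v w] tournament_asym[OF Tx, of v w] assms pverts_Tx by auto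

lemma edge_card: "e \<in> hedges H \<Longrightarrow> e \<subseteq> hverts H \<and> card e = 3"
  using uniform by (simp add: three_uniform_def)

lemma link_iff: "(v, w) \<in> parcs G \<longleftrightarrow> {x, v, w} \<in> hedges H"
proof
  assume "{x, v, w} \<in> hedges H"
  moreover from this have "{x, v, w} \<subseteq> hverts H" "card {x, v, w} = 3" using edge_card by blast+
  moreover from this(2) have "v \<noteq> w" "v \<noteq> x" "w \<noteq> x" by (auto simp: card_insert_if split: if_splits)
  ultimately show "(v, w) \<in> parcs G" by (auto simp: link_graph_def)
qed (simp add: link_graph_def)

lemma link_verts: "(v, w) \<in> parcs G \<Longrightarrow> v \<in> W \<and> w \<in> W \<and> v \<noteq> w"
  by (simp add: link_graph_def)

lemma link_sym: "(v, w) \<in> parcs G \<Longrightarrow> (w, v) \<in> parcs G"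
  by (simp add: link_iff insert_commute)

lemma pverts_link: "pverts G = W"
  by (simp add: link_graph_def)

lemma isolated_iff: "v \<in> I \<longleftrightarrow> v \<in> W \<and> (\<forall>w. (v, w) \<notin> parcs G)"
  using link_verts unfolding isolated_verts_def pverts_link by blast

lemma fin_link: "pair_fin_digraph G"
proof
  show "finite (pverts G)" using finite_H by (simp add: link_graph_def)
  have "parcs G \<subseteq> W \<times> W" using link_verts by auto
  thus "finite (parcs G)" using finite_H by (meson finite_Diff finite_SigmaI finite_subset)
  show "fst e \<in> pverts G" "snd e \<in> pverts G" if "e \<in> parcs G" for e
    using that link_verts[of "fst e" "snd e"] unfolding pverts_link by simp_all
qed

text \<open>If no edge contained \<open>x\<close>, every edge would lie in \<open>W\<close>, and
  \<open>W\<close> would be a nontrivial module.\<close>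

lemma link_nonempty: obtains v w where "(v, w) \<in> parcs G"
proof (rule ccontr)
  assume "\<not> thesis"
  hence none: "(v, w) \<notin> parcs G" for v w using that by blast
  have "e \<subseteq> W" if e: "e \<in> hedges H" for e
  proof -
    have "x \<notin> e"
    proof
      assume "x \<in> e"
      have "card (e - {x}) = 2" using edge_card[OF e] \<open>x \<in> e\<close> by simp
      then obtain v w where "e - {x} = {v, w}" by (auto simp: card_2_iff)
      hence "e = {x, v, w}" using \<open>x \<in> e\<close> by blast
      thus False using none link_iff e by blast
    qed
    thus ?thesis using edge_card[OF e] by blast
  qed
  hence "is_module H W" unfolding is_module_def by blast
  hence "trivial_module H W" using prime unfolding prime_hypergraph_def by blast
  moreover have "card W \<ge> 3" using prime_del by (simp add: prime_hypergraph_def hdel_def)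
  moreover have "W \<noteq> hverts H" using x by blast
  moreover have "\<not> card {u} \<ge> 3" "\<not> card {} \<ge> 3" for u :: 'a by simp_all
  ultimately show False unfolding trivial_module_def by metis
qed

text \<open>On triples without \<open>x\<close>, both \<open>H\<close> and \<open>C3 T\<close> are
  governed by \<open>Tx\<close>. A triple \<open>x v w\<close> is a three-cycle of \<open>T\<close>
  exactly when the arc of \<open>Tx\<close> between \<open>v\<close> and \<open>w\<close> leads from
  a vertex dominated by \<open>x\<close> to one that is not.\<close>

lemma realization_iff_splits:
  assumes T: "tournament T" and V: "pverts T = hverts H" and del: "delete_vertex T x = Tx"
  shows "realization T H \<longleftrightarrow> splits {v. (x, v) \<in> parcs T}"
proof -
  let ?N = "{v. (x, v) \<in> parcs T}"
  have N: "?N \<subseteq> W" using tournament_verts[OF T] V by blast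
  have in_N: "(v, x) \<in> parcs T \<longleftrightarrow> v \<notin> ?N" if "v \<in> W" for v
    using that tournament_total[OF T, of v x] tournament_asym[OF T, of v x] V x by auto
  have arc: "(v, w) \<in> parcs T \<longleftrightarrow> (v, w) \<in> parcs Tx" if "v \<in> W" "w \<in> W" for v w
    using that in_delete_vertex[of v w T x] del by simp
  have xvw: "{x, v, w} \<in> hedges (C3 T) \<longleftrightarrow>
    v \<in> ?N \<and> w \<notin> ?N \<and> (v, w) \<in> parcs Tx \<or> w \<in> ?N \<and> v \<notin> ?N \<and> (w, v) \<in> parcs Tx"
    if "v \<in> W" "w \<in> W" for v w
    unfolding triple_in_hedges_C3[OF T] cyclic_def
    using in_N[OF that(1)] in_N[OF that(2)] arc[OF that] arc[OF that(2,1)] by blast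
  have "realization T H \<longleftrightarrow> H = C3 T" using T V unfolding realization_def by blast
  also have "\<dots> \<longleftrightarrow> (\<forall>v\<in>W. \<forall>w\<in>W. {x, v, w} \<in> hedges H \<longleftrightarrow> {x, v, w} \<in> hedges (C3 T))"
    (is "_ \<longleftrightarrow> ?R")
  proof
    assume "H = C3 T"
    thus ?R by metis
  next
    assume R: ?R
    have card: "e \<subseteq> hverts H \<and> card e = 3" if "e \<in> hedges H \<or> e \<in> hedges (C3 T)" for e
      using that edge_card[of e] V by (auto simp: C3_def)
    have iff: "e \<in> hedges H \<longleftrightarrow> e \<in> hedges (C3 T)" if e: "e \<subseteq> hverts H" "card e = 3" for e
    proof (cases "x \<in> e")
      case True
      have "card (e - {x}) = 2" using e True by simp
      then obtain v w where vw: "e - {x} = {v, w}" by (auto simp: card_2_iff)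
      hence "e = {x, v, w}" "v \<in> W" "w \<in> W" using True e by blast+
      thus ?thesis using R by blast
    next
      case False
      obtain a b c where abc: "e = {a, b, c}" using e(2) by (auto simp: card_3_iff)
      have W: "a \<in> W" "b \<in> W" "c \<in> W" using abc e(1) False by blast+
      have "e \<in> hedges H \<longleftrightarrow> e \<in> hedges (hdel H x)" using e(1) False by (auto simp: hdel_def)
      also have "\<dots> \<longleftrightarrow> cyclic Tx a b c \<or> cyclic Tx b a c"
        unfolding hdel_eq abc by (rule triple_in_hedges_C3[OF Tx])
      also have "\<dots> \<longleftrightarrow> e \<in> hedges (C3 T)"
        unfolding abc triple_in_hedges_C3[OF T] cyclic_def using W arc by simp
      finally show ?thesis .
    qed
    have "hedges H = hedges (C3 T)" using card iff by blast
    moreover have "hverts H = hverts (C3 T)" using V by (simp add: hverts_C3)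
    ultimately show "H = C3 T" by (intro hypergraph.equality) simp_all
  qed
  also have "\<dots> \<longleftrightarrow> splits ?N"
    unfolding splits_def link_iff using N xvw by auto
  finally show ?thesis .
qed

definition extend :: "'a set \<Rightarrow> 'a pair_pre_digraph" where
  "extend N = \<lparr>pverts = hverts H, parcs = parcs Tx \<union> {x} \<times> N \<union> (W - N) \<times> {x}\<rparr>"

lemma extend:
  assumes N: "N \<subseteq> W"
  shows tournament_extend: "tournament (extend N)"
    and delete_extend: "delete_vertex (extend N) x = Tx"
    and out_extend: "{v. (x, v) \<in> parcs (extend N)} = N"
proof -
  have sub: "parcs Tx \<subseteq> W \<times> W" using tournament_verts[OF Tx] pverts_Tx by auto
  have loop: "(v, v) \<notin> parcs Tx" for v using tournament_verts[OF Tx] by blast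
  show "tournament (extend N)"
    unfolding tournament_iff
  proof (intro conjI ballI allI impI)
    show "finite (pverts (extend N))" using finite_H by (simp add: extend_def)
    show "parcs (extend N) \<subseteq> pverts (extend N) \<times> pverts (extend N)"
      using sub N x by (auto simp: extend_def)
    show "(v, v) \<notin> parcs (extend N)" for v using loop N by (auto simp: extend_def)
    show "(v, w) \<in> parcs (extend N) \<longleftrightarrow> (w, v) \<notin> parcs (extend N)"
      if "v \<in> pverts (extend N)" "w \<in> pverts (extend N)" "v \<noteq> w" for v w
    proof (cases "v = x \<or> w = x")
      case True
      thus ?thesis using that sub N by (auto simp: extend_def)
    next
      case False
      hence vw: "v \<in> W" "w \<in> W" using that by (auto simp: extend_def)
      have "(p, q) \<in> parcs (extend N) \<longleftrightarrow> (p, q) \<in> parcs Tx" if "p \<noteq> x" "q \<noteq> x" for p q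
        using that by (simp add: extend_def)
      thus ?thesis using Tx_flip[OF vw that(3)] False by simp
    qed
  qed
  have "parcs (delete_vertex (extend N) x) = parcs Tx"
    using sub by (auto simp: in_delete_vertex extend_def)
  moreover have "pverts (delete_vertex (extend N) x) = pverts Tx"
    by (simp add: delete_vertex_def extend_def pverts_Tx)
  ultimately show "delete_vertex (extend N) x = Tx" by (intro pair_pre_digraph.equality) simp_all
  show "{v. (x, v) \<in> parcs (extend N)} = N" using sub by (auto simp: extend_def)
qed

lemma realization_extend:
  assumes "splits N"
  shows "realization (extend N) H"
proof -
  have N: "N \<subseteq> W" using assms by (simp add: splits_def)
  show ?thesis
    using realization_iff_splits[OF tournament_extend[OF N] _ delete_extend[OF N]] assms out_extend[OF N]
    by (simp add: extend_def)
qed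

lemma realization_splits:
  assumes "realization T H" "delete_vertex T x = Tx"
  shows "splits {v. (x, v) \<in> parcs T}"
  using realization_iff_splits[of T] assms unfolding realization_def by blast

lemma Tx_neq_dual: "dual Tx \<noteq> Tx"
proof
  assume eq: "dual Tx = Tx"
  have "\<not> card W \<le> 1" using prime_del by (simp add: prime_hypergraph_def hdel_def)
  then obtain a b where ab: "a \<in> W" "b \<in> W" "a \<noteq> b"
    using finite_H by (metis One_nat_def card_le_Suc0_iff_eq finite_Diff)
  have "(p, q) \<in> parcs Tx" if "(q, p) \<in> parcs Tx" for p q
    using that arg_cong[OF eq, of parcs] unfolding dual_def by auto
  thus False using Tx_flip[OF ab] by blast
qed

text \<open>If \<open>T'\<close> were the dual of \<open>T\<close>, deleting \<open>x\<close> would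
  give \<open>dual Tx\<close>, which differs from \<open>Tx\<close>.\<close>

lemma realization_unique:
  assumes "realization T H" "delete_vertex T x = Tx" "realization T' H" "delete_vertex T' x = Tx"
  shows "T' = T"
  using prime_realization_unique_up_to_dual[OF prime assms(1,3)] assms(2,4)
    delete_vertex_dual[of T x] Tx_neq_dual by auto

text \<open>Serves to identify the set built from \<open>cond_M1\<close> and \<open>cond_M2\<close>
  with the out-neighbourhood of \<open>x\<close> in a realization extending
  \<open>Tx\<close>.\<close>

lemma splits_unique:
  assumes "splits N" "splits N'"
  shows "N = N'"
proof -
  have N: "N \<subseteq> W" "N' \<subseteq> W" using assms unfolding splits_def by blast+
  have "extend N = extend N'"
    using realization_unique[OF realization_extend[OF assms(2)] delete_extend[OF N(2)]
        realization_extend[OF assms(1)] delete_extend[OF N(1)]] .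
  thus ?thesis using out_extend[OF N(1)] out_extend[OF N(2)] by metis
qed

text \<open>A realization of \<open>H\<close> restricts to one of the prime \<open>hdel H x\<close>,
  hence to \<open>Tx\<close> or its dual; in the second case the dual realization of
  \<open>H\<close> restricts to \<open>Tx\<close>.\<close>

lemma realizable_iff_splits: "realizable H \<longleftrightarrow> (\<exists>N. splits N)"
proof
  assume "realizable H"
  then obtain T where T: "realization T H" by (auto simp: realizable_def)
  have "delete_vertex T x = Tx \<or> delete_vertex T x = dual Tx"
    by (rule prime_realization_unique_up_to_dual[OF prime_del realization_Tx realization_delete_vertex[OF T]])
  thus "\<exists>N. splits N"
  proof
    assume "delete_vertex T x = Tx"
    thus ?thesis using realization_splits[OF T] by blast
  next
    assume "delete_vertex T x = dual Tx"
    hence "delete_vertex (dual T) x = Tx" by (simp add: delete_vertex_dual dual_dual)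
    thus ?thesis using realization_splits[OF realization_dual[OF T]] by blast
  qed
next
  assume "\<exists>N. splits N"
  thus "realizable H" using realization_extend unfolding realizable_def by blast
qed

section \<open>Equivalence of \<open>splits\<close> with the conditions (M1) and (M2)\<close>

lemma splitsD:
  assumes "splits N" "v \<in> W" "w \<in> W"
  shows "(v, w) \<in> parcs G \<longleftrightarrow>
    v \<in> N \<and> w \<notin> N \<and> (v, w) \<in> parcs Tx \<or> w \<in> N \<and> v \<notin> N \<and> (w, v) \<in> parcs Tx"
  using assms unfolding splits_def by blast

lemma dual_extension: "vertex_extension H x (dual Tx)"
  using uniform prime x prime_del realization_dual[OF realization_Tx] by unfold_locales

text \<open>Reversing all arcs exchanges the two sides of \<open>x\<close>, which transfers results
  on \<open>N\<close> and \<open>Y_minus\<close> to \<open>W - N\<close> and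
  \<open>Y_plus\<close>.\<close>

lemma splits_dual:
  assumes "splits N"
  shows "vertex_extension.splits H x (dual Tx) (W - N)"
proof -
  interpret d: vertex_extension H x "dual Tx" by (rule dual_extension)
  have "(v, w) \<in> parcs (dual Tx) \<longleftrightarrow> (w, v) \<in> parcs Tx" for v w by (simp add: dual_def)
  thus ?thesis unfolding d.splits_def using splitsD[OF assms] by blast
qed

text \<open>An arc of \<open>Tx\<close> from \<open>N\<close> to its complement would be an edge of
  the link graph, and an isolated vertex lies on none.\<close>

lemma isolated_crossing:
  assumes "splits N" "v \<in> N" "w \<in> W - N" "v \<in> I \<or> w \<in> I"
  shows "(w, v) \<in> parcs Tx"
proof -
  have W: "v \<in> W" "w \<in> W" using assms unfolding splits_def by blast+
  have "(v, w) \<notin> parcs G" using assms(4) link_sym isolated_iff by blast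
  hence "(v, w) \<notin> parcs Tx" using splitsD[OF assms(1) W] assms(2,3) by blast
  thus ?thesis using Tx_flip[OF W] assms(2,3) by blast
qed

lemma Y_minus_subset_splits:
  assumes N: "splits N"
  shows "Y_minus Tx I (N - I) \<subseteq> N"
proof
  fix v assume "v \<in> Y_minus Tx I (N - I)"
  thus "v \<in> N"
  proof (induction rule: Y_minus_induct)
    case (step u v)
    have "v \<in> W" using step isolated_iff by blast
    thus ?case using isolated_crossing[OF N step(1), of v] step tournament_asym[OF Tx] by blast
  qed simp
qed

text \<open>The isolated vertices of \<open>N\<close> that are not reached form a module together with \<open>x\<close>.\<close>

lemma splits_isolated_reached:
  assumes N: "splits N"
  shows "N \<inter> I \<subseteq> Y_minus Tx I (N - I)"
proof (rule ccontr)
  define Z where "Z = N \<inter> I - Y_minus Tx I (N - I)"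
  assume "\<not> ?thesis"
  hence Z: "Z \<noteq> {}" by (auto simp: Z_def)
  have NW: "N \<subseteq> W" using N unfolding splits_def by blast
  have ZN: "Z \<subseteq> N" by (auto simp: Z_def)
  let ?T = "extend N"
  \<comment> \<open>Whether \<open>u\<close> dominates an element of \<open>insert x Z\<close>
    depends on \<open>u\<close> alone. For \<open>x\<close> this is how \<open>extend\<close> is
    built. An arc to \<open>Z\<close> from inside \<open>N\<close> would make its head reached; from
    outside \<open>N\<close>, \<open>isolated_crossing\<close> provides the arc.\<close>
  have "(u, m) \<in> parcs ?T \<longleftrightarrow> u \<notin> N" if u: "u \<in> hverts H - insert x Z" and m: "m \<in> insert x Z" for u m
  proof (cases "m = x")
    case True
    thus ?thesis using u tournament_verts[OF Tx] pverts_Tx by (auto simp: extend_def)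
  next
    case False
    have mZ: "m \<in> Z" using m False by blast
    have ux: "u \<in> W" using u by blast
    have "(u, m) \<in> parcs ?T \<longleftrightarrow> (u, m) \<in> parcs Tx" using False ux by (auto simp: extend_def)
    also have "\<dots> \<longleftrightarrow> u \<notin> N"
    proof
      assume um: "(u, m) \<in> parcs Tx"
      show "u \<notin> N"
      proof
        assume "u \<in> N"
        have "u \<in> N - I \<or> u \<in> Y_minus Tx I (N - I)" using \<open>u \<in> N\<close> u by (auto simp: Z_def)
        hence "m \<in> Y_minus Tx I (N - I)"
          using um mZ Y_minus_start[of u "N - I" m I Tx] Y_minus_step[of u Tx I "N - I" m]
          unfolding Z_def by blast
        thus False using mZ by (simp add: Z_def)
      qed
    next
      assume "u \<notin> N"
      thus "(u, m) \<in> parcs Tx" using isolated_crossing[OF N, of m u] mZ ux by (auto simp: Z_def)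
    qed
    finally show ?thesis .
  qed
  hence "arc_module ?T (insert x Z)"
    using ZN NW x unfolding arc_module_def by (auto simp: extend_def)
  hence "insert x Z = {} \<or> insert x Z = hverts H \<or> (\<exists>v. insert x Z = {v})"
    using prime_arc_module_trivial[OF realization_extend[OF N] prime] by blast
  moreover have "x \<notin> Z" using ZN NW by blast
  ultimately have "insert x Z = hverts H" using Z by blast
  \<comment> \<open>Every vertex other than \<open>x\<close> is now in \<open>Z\<close> and so
    isolated, although the link graph has an edge.\<close>
  hence "W \<subseteq> I" using Z_def by blast
  thus False using link_nonempty link_verts isolated_iff by (metis subsetD)
qed

text \<open>Every edge of the link graph joins \<open>N - I\<close> to \<open>W - N - I\<close>, and
  there is at least one edge, so both blocks are nonempty.\<close>

lemma M1_if_splits: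
  assumes N: "splits N"
  shows "cond_M1 H x Tx (N - I) (W - N - I)"
proof -
  have NW: "N \<subseteq> W" using N unfolding splits_def by blast
  have cross: "v \<in> N - I \<and> w \<in> W - N - I \<or> v \<in> W - N - I \<and> w \<in> N - I" if vw: "(v, w) \<in> parcs G" for v w
  proof -
    have "v \<in> W" "w \<in> W" "v \<notin> I" "w \<notin> I" using vw link_verts link_sym isolated_iff by blast+
    thus ?thesis using splitsD[OF N, of v w] vw by blast
  qed
  obtain v w where "(v, w) \<in> parcs G" by (rule link_nonempty)
  hence "bipartition (W - I) (N - I) (W - N - I)"
    unfolding bipartition_iff using NW cross[of v w] by blast
  moreover have "bipartite_with C ((N - I) \<inter> verts C) ((W - N - I) \<inter> verts C)"
    if C: "is_component (with_proj G) C" "card (verts C) \<ge> 2" for C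
  proof -
    note CD = componentD[OF C(1)]
    have arcs: "fst e \<in> (N - I) \<inter> verts C \<and> snd e \<in> (W - N - I) \<inter> verts C \<or>
      fst e \<in> (W - N - I) \<inter> verts C \<and> snd e \<in> (N - I) \<inter> verts C" if e: "e \<in> arcs C" for e
    proof -
      have "(fst e, snd e) \<in> parcs G" using CD(2) e by auto
      thus ?thesis using cross CD(5)[OF e] by blast
    qed
    \<comment> \<open>Every vertex of the component is an end of one of its arcs. This keeps
      isolated vertices out of the component and puts a vertex of it into each block, as
      \<open>bipartition\<close> demands.\<close>
    have inc: "\<exists>e\<in>arcs C. v = fst e \<or> v = snd e" if "v \<in> verts C" for v
    proof -
      obtain w where "(v, w) \<in> arcs C \<or> (w, v) \<in> arcs C"
        using component_vertex_not_isolated[OF C \<open>v \<in> verts C\<close>] by blast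
      thus ?thesis by force
    qed
    have "verts C \<subseteq> W - I" using inc arcs NW by blast
    moreover obtain v where "v \<in> verts C" using C(2) by fastforce
    ultimately have "bipartition (verts C) ((N - I) \<inter> verts C) ((W - N - I) \<inter> verts C)"
      unfolding bipartition_iff using inc[of v] arcs by blast
    thus ?thesis unfolding bipartite_with_def CD(3,4) using arcs by blast
  qed
  moreover have "(vm, vp) \<in> parcs G \<longleftrightarrow> (vm, vp) \<in> parcs Tx" if "vm \<in> N - I" "vp \<in> W - N - I" for vm vp
    using splitsD[OF N, of vm vp] that NW by blast
  ultimately show ?thesis unfolding cond_M1_def Let_def by blast
qed

text \<open>Here \<open>Y_minus\<close> is the isolated part of \<open>N\<close> and, by duality,
  \<open>Y_plus\<close> is the isolated part of \<open>W - N\<close>; the required arcs are then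
  instances of \<open>isolated_crossing\<close>.\<close>

lemma M2_if_splits:
  assumes N: "splits N"
  shows "cond_M2 H x Tx (N - I) (W - N - I)"
proof -
  interpret d: vertex_extension H x "dual Tx" by (rule dual_extension)
  note dN = splits_dual[OF N]
  have NW: "N \<subseteq> W" and IW: "I \<subseteq> W" using N isolated_iff unfolding splits_def by blast+
  let ?Ym = "Y_minus Tx I (N - I)" and ?Yp = "Y_plus Tx I (W - N - I)"
  have Ym: "?Ym = N \<inter> I"
    using Y_minus_subset_splits[OF N] splits_isolated_reached[OF N] Y_minus_subset[of Tx I "N - I"] by blast
  have Yp: "?Yp = (W - N) \<inter> I"
    unfolding Y_plus_eq using d.Y_minus_subset_splits[OF dN] d.splits_isolated_reached[OF dN]
      Y_minus_subset[of "dual Tx" I "W - N - I"] by blast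
  show ?thesis unfolding cond_M2_def Let_def Ym Yp
    using isolated_crossing[OF N] NW IW by blast
qed

lemma splits_if_M:
  assumes M1: "cond_M1 H x Tx Xm Xp" and M2: "cond_M2 H x Tx Xm Xp"
  shows "splits (Xm \<union> Y_minus Tx I Xm)"
proof -
  let ?Ym = "Y_minus Tx I Xm" and ?Yp = "Y_plus Tx I Xp"
  let ?N = "Xm \<union> ?Ym"
  have X: "Xm \<union> Xp = W - I" "Xm \<inter> Xp = {}"
    and comp: "\<And>C. is_component (with_proj G) C \<Longrightarrow> card (verts C) \<ge> 2 \<Longrightarrow>
      bipartite_with C (Xm \<inter> verts C) (Xp \<inter> verts C)"
    and arcX: "\<And>v w. v \<in> Xm \<Longrightarrow> w \<in> Xp \<Longrightarrow> (v, w) \<in> parcs G \<longleftrightarrow> (v, w) \<in> parcs Tx"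
    using M1 unfolding cond_M1_def Let_def bipartition_iff by blast+
  have Y: "?Ym \<inter> ?Yp = {}" "?Ym \<union> ?Yp = I"
    and YX: "\<And>v w. v \<in> ?Yp \<Longrightarrow> w \<in> Xm \<Longrightarrow> (v, w) \<in> parcs Tx"
    and XY: "\<And>v w. v \<in> Xp \<Longrightarrow> w \<in> ?Ym \<Longrightarrow> (v, w) \<in> parcs Tx"
    and YY: "\<And>v w. v \<in> ?Yp \<Longrightarrow> w \<in> ?Ym \<Longrightarrow> (v, w) \<in> parcs Tx"
    using M2 unfolding cond_M2_def Let_def by blast+
  have NW: "?N \<subseteq> W" using X Y isolated_iff by blast
  have out: "w \<in> Xp \<union> ?Yp" if "w \<in> W" "w \<notin> ?N" for w using that X Y by blast
  \<comment> \<open>An arc leaving \<open>?N\<close> goes from \<open>Xm\<close> to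
    \<open>Xp\<close>, where \<open>cond_M1\<close> makes it an edge, or has an end in
    \<open>?Ym\<close> or \<open>?Yp\<close>, where \<open>cond_M2\<close> orients the pair the
    other way.\<close>
  have to: "(v, w) \<in> parcs G" if "v \<in> ?N" "w \<in> W" "w \<notin> ?N" "(v, w) \<in> parcs Tx" for v w
    using that out[OF that(2,3)] arcX[of v w] YX[of w v] XY[of w v] YY[of w v] tournament_asym[OF Tx, of v w]
    by blast
  \<comment> \<open>The edge lies in a component with at least two vertices, whose bipartition puts
    one end in \<open>Xm\<close> and the other in \<open>Xp\<close>.\<close>
  have adj: "v \<in> ?N \<and> w \<notin> ?N \<and> (v, w) \<in> parcs Tx \<or> w \<in> ?N \<and> v \<notin> ?N \<and> (w, v) \<in> parcs Tx"
    if vw: "(v, w) \<in> parcs G" for v w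
  proof -
    obtain C where C: "is_component (with_proj G) C" "(v, w) \<in> arcs C" "{v, w} \<subseteq> verts C"
      using component_of_arc[OF fin_link vw] by blast
    have "verts C \<subseteq> W" using componentD(1)[OF C(1)] unfolding pverts_link .
    hence "finite (verts C)" using finite_H by (meson finite_Diff finite_subset)
    moreover have "card {v, w} = 2" using link_verts[OF vw] by simp
    ultimately have "card (verts C) \<ge> 2" using C(3) by (metis card_mono)
    hence "bipartite_with C (Xm \<inter> verts C) (Xp \<inter> verts C)" using comp C(1) by blast
    hence "v \<in> Xm \<and> w \<in> Xp \<or> v \<in> Xp \<and> w \<in> Xm"
      using C(2) unfolding bipartite_with_def componentD(3,4)[OF C(1)] by fastforce
    moreover have "Xp \<inter> ?N = {}" using X Y by blast
    ultimately show ?thesis using arcX vw link_sym by blast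
  qed
  show ?thesis unfolding splits_def using NW to adj link_sym by meson
qed

end

section \<open>The criterion and the unique extension of \<open>Tx\<close>\<close>

theorem theorem55:
  fixes H :: "'a hypergraph" and x :: 'a and Tx :: "'a pair_pre_digraph"
  assumes "three_uniform H"
    and "prime_hypergraph H"
    and "\<not> critical H"
    and "x \<in> hverts H"
    and "prime_hypergraph (hdel H x)"
    and "realization Tx (hdel H x)"
  shows "(realizable H \<longleftrightarrow> (\<exists>Xm Xp. cond_M1 H x Tx Xm Xp \<and> cond_M2 H x Tx Xm Xp)) \<and>
    (realizable H \<longrightarrow>
      (\<exists>!T. realization T H \<and> pre_digraph.del_vert (with_proj T) x = with_proj Tx)) \<and>
    (\<forall>Xm Xp T. cond_M1 H x Tx Xm Xp \<and> cond_M2 H x Tx Xm Xp \<and>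
        realization T H \<and> pre_digraph.del_vert (with_proj T) x = with_proj Tx \<longrightarrow>
      (\<forall>xm \<in> Xm. (x, xm) \<in> parcs T) \<and>
      (\<forall>xp \<in> Xp. (xp, x) \<in> parcs T) \<and>
      (\<forall>ym \<in> Y_minus Tx (isolated_verts (link_graph H x)) Xm. (x, ym) \<in> parcs T) \<and>
      (\<forall>yp \<in> Y_plus Tx (isolated_verts (link_graph H x)) Xp. (yp, x) \<in> parcs T))"
  unfolding del_vert_with_proj with_proj_eq_iff
proof (intro conjI impI allI)
  interpret vertex_extension H x Tx using assms by unfold_locales
  show "realizable H \<longleftrightarrow> (\<exists>Xm Xp. cond_M1 H x Tx Xm Xp \<and> cond_M2 H x Tx Xm Xp)"
    unfolding realizable_iff_splits using M1_if_splits M2_if_splits splits_if_M by blast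
  show "\<exists>!T. realization T H \<and> delete_vertex T x = Tx" if "realizable H"
  proof -
    obtain N where N: "splits N" using \<open>realizable H\<close> unfolding realizable_iff_splits by blast
    hence "N \<subseteq> W" by (simp add: splits_def)
    show ?thesis
      using realization_extend[OF N] delete_extend[OF \<open>N \<subseteq> W\<close>] realization_unique by blast
  qed
  fix Xm Xp T
  assume *: "cond_M1 H x Tx Xm Xp \<and> cond_M2 H x Tx Xm Xp \<and> realization T H \<and> delete_vertex T x = Tx"
  let ?N = "{v. (x, v) \<in> parcs T}"
  have T: "tournament T" "pverts T = hverts H" using * unfolding realization_def by blast+
  \<comment> \<open>The set built from any admissible \<open>Xm\<close> and \<open>Xp\<close>
    splits, so by uniqueness it is the out-neighbourhood of \<open>x\<close> in \<open>T\<close>;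
    \<open>Xp\<close> and \<open>Y_plus\<close> then lie in its complement.\<close>
  have N: "Xm \<union> Y_minus Tx I Xm = ?N"
    using splits_unique[OF splits_if_M realization_splits] * by blast
  have X: "Xm \<union> Xp = W - I" "Xm \<inter> Xp = {}"
    using * unfolding cond_M1_def Let_def bipartition_iff by blast+
  have Y: "Y_minus Tx I Xm \<inter> Y_plus Tx I Xp = {}" "Y_minus Tx I Xm \<union> Y_plus Tx I Xp = I"
    using * unfolding cond_M2_def Let_def by blast+
  have into: "(v, x) \<in> parcs T" if "v \<in> W" "v \<notin> ?N" for v
    using that tournament_total[OF T(1), of v x] T(2) x by blast
  have "I \<subseteq> W" using isolated_iff by blast
  show "\<forall>xm\<in>Xm. (x, xm) \<in> parcs T" "\<forall>ym\<in>Y_minus Tx I Xm. (x, ym) \<in> parcs T"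
    using N by blast+
  have "v \<in> W \<and> v \<notin> ?N" if "v \<in> Xp \<or> v \<in> Y_plus Tx I Xp" for v
    unfolding N[symmetric] using that X Y \<open>I \<subseteq> W\<close> by blast
  thus "\<forall>xp\<in>Xp. (xp, x) \<in> parcs T" "\<forall>yp\<in>Y_plus Tx I Xp. (yp, x) \<in> parcs T"
    using into by blast+
qed

end
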